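(* Let $V$ denote the space of all tuples $(F,G)$ in which $F$ is a smooth function of $\eta$ and a finite but unspecified number of the derivatives $w_{0l}$, $l\ge 1$, and $G$ is a smooth function of $\xi$ and a finite but unspecified number of the derivatives $w_{k0}$, $k\ge 1$ (all such tuples are conserved currents of the equation $w_{\xi\eta}=0$). Let $V_0$ denote the subspace of trivial conserved currents of this equation belonging to $V$. Then the space of (local) conservation laws of the equation $w_{\xi\eta}=0$ is naturally isomorphic to the quotient of the space $V$ by the subspace $V_0$.
   Context: The equation is $\mathcal W$: $w_{\xi\eta}=0$ for an unknown function $w=w(\xi,\eta)$ of two independent variables. Write $w_{kl}:=\partial^{k+l}w/\partial\xi^k\partial\eta^l$, $k,l\in\mathbb N_0=\{0,1,2,\dots\}$ (so $w_{00}=w$), regarded as jet variables. A differential function of $w$ is a smooth function of $\xi$, $\eta$ and finitely many $w_{kl}$. The total derivative operators are $\mathrm D_\xi=\partial_\xi+\sum_{k,l\ge0}w_{k+1,l}\partial_{w_{kl}}$ and $\mathrm D_\eta=\partial_\eta+\sum_{k,l\ge0}w_{k,l+1}\partial_{w_{kl}}$. A differential function vanishes on solutions of $\mathcal W$ if it vanishes whenever $w_{kl}=0$ for all $k,l\ge1$. A conserved current of $\mathcal W$ is a pair $(F,G)$ of differential functions such that $\mathrm D_\xi F+\mathrm D_\eta G$ vanishes on solutions of $\mathcal W$. A conserved current is trivial if it is of the form $(F'+\mathrm D_\eta H,\,G'-\mathrm D_\xi H)$, where $F',G',H$ are differential functions and $F',G'$ vanish on solutions of $\mathcal W$. Two conserved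 currents are equivalent if their difference is trivial. The space of (local) conservation laws of $\mathcal W$ is the quotient of the space of conserved currents by the subspace of trivial ones. "Naturally isomorphic" means that the isomorphism is induced by the inclusion of $V$ into the space of conserved currents, i.e., it maps the coset of $(F,G)\in V$ to the conservation law containing $(F,G)$. All considerations are local: differential functions may be restricted to a sufficiently small neighbourhood of a point of the solution set of $\mathcal W$ in the jet space. *)

theory Defs
  imports "HOL-Analysis.Analysis" "HOL-Library.Function_Algebras"
begin

section \<open>Pointwise vector space structure on functions\<close>

instantiation "fun" :: (type, real_vector) real_vector
begin

definition scaleR_fun :: "real \<Rightarrow> ('a \<Rightarrow> 'b) \<Rightarrow> 'a \<Rightarrow> 'b"
  where "scaleR_fun c f = (\<lambda>x. c *\<^sub>R f x)"

instance
  by standard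
    (auto simp: scaleR_fun_def fun_eq_iff plus_fun_def scaleR_add_right scaleR_add_left)

end


section \<open>Quotients of subspaces\<close>

definition quotient_space :: "'v::real_vector set \<Rightarrow> 'v set \<Rightarrow> 'v set set"
  where "quotient_space A B = (\<lambda>a. a +o B) ` A"

text \<open>Cosets of \<open>B\<close> are added as sets. For scalar multiplication \<open>B\<close> is added once more,
  so that multiplication by \<open>0\<close> yields the coset \<open>B\<close> rather than the set \<open>{0}\<close>.\<close>

definition coset_scale :: "'v::real_vector set \<Rightarrow> real \<Rightarrow> 'v set \<Rightarrow> 'v set"
  where "coset_scale B c X = (\<Union>x\<in>X. (c *\<^sub>R x) +o B)"

definition linear_on_cosets ::
    "'v::real_vector set \<Rightarrow> 'v set \<Rightarrow> 'w::real_vector set \<Rightarrow> ('v set \<Rightarrow> 'w set) \<Rightarrow> bool"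
  where "linear_on_cosets A B D \<Phi> \<longleftrightarrow>
    (\<forall>X\<in>quotient_space A B. \<forall>Y\<in>quotient_space A B. \<Phi> (X + Y) = \<Phi> X + \<Phi> Y) \<and>
    (\<forall>c. \<forall>X\<in>quotient_space A B. \<Phi> (coset_scale B c X) = coset_scale D c (\<Phi> X))"


section \<open>Jet space and differential functions\<close>

text \<open>A point of the jet space assigns a value to \<open>\<xi>\<close>, to \<open>\<eta>\<close> and to each \<open>w\<^sub>k\<^sub>l\<close>.
  The space of these assignments carries the product topology, so a neighbourhood of a point
  restricts only finitely many coordinates.\<close>

datatype jet_var = Xi | Eta | W nat nat

type_synonym jet = "jet_var \<Rightarrow> real"

definition pd :: "jet_var \<Rightarrow> (jet \<Rightarrow> real) \<Rightarrow> jet \<Rightarrow> real"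
  where "pd v f x = deriv (\<lambda>t. f (x(v := t))) (x v)"

text \<open>\<open>C\<^sup>\<infinity>\<close>: all iterated partial derivatives exist and are continuous. For functions of
  finitely many jet variables continuity in the product topology is continuity in these
  variables. Only meant for open \<open>U\<close>, on which the values of \<^const>\<open>pd\<close> depend only on the
  values of the function on \<open>U\<close>.\<close>

definition smooth_on :: "jet set \<Rightarrow> (jet \<Rightarrow> real) \<Rightarrow> bool"
  where "smooth_on U f \<longleftrightarrow>
    (\<forall>vs. continuous_on U (foldr pd vs f) \<and>
      (\<forall>v. \<forall>x\<in>U. (\<lambda>t. foldr pd vs f (x(v := t))) field_differentiable at (x v)))"

definition depends_only_on :: "jet set \<Rightarrow> jet_var set \<Rightarrow> (jet \<Rightarrow> real) \<Rightarrow> bool"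
  where "depends_only_on U S f \<longleftrightarrow>
    (\<forall>x\<in>U. \<forall>y\<in>U. (\<forall>v\<in>S. x v = y v) \<longrightarrow> f x = f y)"

text \<open>Everything below is local at a point \<open>p\<close> of the jet space. A local object is represented by
  a total function of which only the germ at \<open>p\<close> matters; its values away from \<open>p\<close> are arbitrary.
  Two representatives of the same germ differ by a function that vanishes near \<open>p\<close>. In particular
  the difference of two representatives of a current is trivial, so that the quotients below
  coincide with the corresponding quotients of spaces of germs.\<close>

definition smooth_function_of :: "jet_var set \<Rightarrow> jet \<Rightarrow> (jet \<Rightarrow> real) \<Rightarrow> bool"
  where "smooth_function_of A p f \<longleftrightarrow>
    (\<exists>U S. open U \<and> p \<in> U \<and> finite S \<and> S \<subseteq> A \<and> smooth_on U f \<and> depends_only_on U S f)"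

definition differential_function :: "jet \<Rightarrow> (jet \<Rightarrow> real) \<Rightarrow> bool"
  where "differential_function p f \<longleftrightarrow> smooth_function_of UNIV p f"

text \<open>For a differential function the sums below range over finite sets near \<open>p\<close>, since almost
  all of its partial derivatives vanish.\<close>

definition D_xi :: "(jet \<Rightarrow> real) \<Rightarrow> jet \<Rightarrow> real"
  where "D_xi f x = pd Xi f x +
    (\<Sum>(k, l)\<in>{(k, l). pd (W k l) f x \<noteq> 0}. x (W (k + 1) l) * pd (W k l) f x)"

definition D_eta :: "(jet \<Rightarrow> real) \<Rightarrow> jet \<Rightarrow> real"
  where "D_eta f x = pd Eta f x +
    (\<Sum>(k, l)\<in>{(k, l). pd (W k l) f x \<noteq> 0}. x (W k (l + 1)) * pd (W k l) f x)"


section \<open>Conservation laws of \<open>w\<^sub>\<xi>\<^sub>\<eta> = 0\<close>\<close>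

definition solution_set :: "jet set"
  where "solution_set = {x. \<forall>k\<ge>1. \<forall>l\<ge>1. x (W k l) = 0}"

definition vanishes_on_solutions :: "jet \<Rightarrow> (jet \<Rightarrow> real) \<Rightarrow> bool"
  where "vanishes_on_solutions p f \<longleftrightarrow> (\<forall>\<^sub>F x in nhds p. x \<in> solution_set \<longrightarrow> f x = 0)"

type_synonym current = "(jet \<Rightarrow> real) \<times> (jet \<Rightarrow> real)"

definition conserved_currents :: "jet \<Rightarrow> current set"
  where "conserved_currents p =
    {(F, G). differential_function p F \<and> differential_function p G \<and>
      vanishes_on_solutions p (\<lambda>x. D_xi F x + D_eta G x)}"

definition trivial_currents :: "jet \<Rightarrow> current set"
  where "trivial_currents p =
    {(F, G) \<in> conserved_currents p. \<exists>F' G' H.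
      differential_function p F' \<and> differential_function p G' \<and> differential_function p H \<and>
      vanishes_on_solutions p F' \<and> vanishes_on_solutions p G' \<and>
      (\<forall>\<^sub>F x in nhds p. F x = F' x + D_eta H x \<and> G x = G' x - D_xi H x)}"

definition conservation_laws :: "jet \<Rightarrow> current set set"
  where "conservation_laws p = quotient_space (conserved_currents p) (trivial_currents p)"

definition V :: "jet \<Rightarrow> current set"
  where "V p = {(F, G).
    smooth_function_of ({Eta} \<union> {W 0 l | l. l \<ge> 1}) p F \<and>
    smooth_function_of ({Xi} \<union> {W k 0 | k. k \<ge> 1}) p G}"

definition V\<^sub>0 :: "jet \<Rightarrow> current set"
  where "V\<^sub>0 p = V p \<inter> trivial_currents p"

end

theory Submission
  imports Defs
begin

text \<open>
  The natural map \<open>V/V\<^sub>0 \<rightarrow>\<close> conservation laws is well defined and injective for the simple reason that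
  \<open>V\<^sub>0\<close> consists of the trivial currents in \<open>V\<close>. The content of the theorem is surjectivity:
  every conserved current \<open>(F, G)\<close> differs from an element of \<open>V\<close> by a trivial one
  (\<open>conserved_current_equivalent_to_V\<close>).

  Up to functions vanishing on solutions, \<open>F\<close> and \<open>G\<close> depend only on \<open>\<xi>, \<eta>, w\<^sub>0\<^sub>0, w\<^sub>k\<^sub>0, w\<^sub>0\<^sub>l\<close>, and on such
  functions the total derivatives act on solutions as two commuting operators
  \<open>X = \<partial>\<^sub>\<xi> + \<Sum> w\<^bsub>k+1,0\<^esub> \<partial>\<^bsub>k0\<^esub>\<close> and \<open>Y = \<partial>\<^sub>\<eta> + \<Sum> w\<^bsub>0,l+1\<^esub> \<partial>\<^bsub>0l\<^esub>\<close>, so that the current is conserved iff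
  \<open>X F + Y G = 0\<close>. One may replace \<open>(F, G)\<close> by \<open>(F - Y H, G + X H)\<close>. If \<open>w\<^bsub>m0\<^esub>\<close> is the highest variable
  among \<open>w\<^sub>0\<^sub>0, w\<^sub>1\<^sub>0, \<dots>\<close> on which \<open>F\<close> depends, then \<open>X F\<close> contains \<open>w\<^bsub>m+1,0\<^esub>\<close> only in the term
  \<open>w\<^bsub>m+1,0\<^esub> \<partial>F/\<partial>w\<^bsub>m0\<^esub>\<close>, whence \<open>\<partial>F/\<partial>w\<^bsub>m0\<^esub> = Y K\<close> for \<open>K = - \<partial>G/\<partial>w\<^bsub>m+1,0\<^esub>\<close> at a fixed value of the higher
  variables. Taking for \<open>H\<close> an antiderivative of \<open>K\<close> with respect to \<open>w\<^bsub>m0\<^esub>\<close> removes \<open>w\<^bsub>m0\<^esub>\<close> from \<open>F\<close>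
  (\<open>eliminate_one_xi_var\<close>). Continue down to \<open>w\<^sub>0\<^sub>0\<close> and finally remove \<open>\<xi>\<close> in the same way, using
  \<open>\<partial>F/\<partial>\<xi> = X F = - Y G\<close>, to arrive at
  \<open>F = F(\<eta>, w\<^sub>0\<^sub>1, w\<^sub>0\<^sub>2, \<dots>)\<close>. Then \<open>X F = 0\<close>, hence \<open>Y G = 0\<close>, and reading this equation from the highest
  \<open>w\<^sub>0\<^sub>l\<close> downwards shows that \<open>G\<close> is a function of \<open>\<xi>, w\<^sub>1\<^sub>0, w\<^sub>2\<^sub>0, \<dots>\<close> (\<open>normal_form\<close>).

  The analysis behind this is integration in a single jet variable over neighbourhoods that are
  star-shaped in each coordinate: smooth functions have smooth antiderivatives, and \<open>\<partial>\<close> in another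
  variable may be taken under the integral. The symmetry of second derivatives, on which the
  commutation of \<open>X\<close> and \<open>Y\<close> rests, is a consequence (\<open>pd_commute\<close>).
\<close>

section \<open>Subspaces and their quotients\<close>

lemma subspaceI_lincomb:
  fixes S :: "'v::real_vector set"
  assumes "0 \<in> S" and "\<And>c x y. x \<in> S \<Longrightarrow> y \<in> S \<Longrightarrow> c *\<^sub>R x + y \<in> S"
  shows "subspace S"
proof (rule subspaceI)
  show "0 \<in> S" by fact
  show "x + y \<in> S" if "x \<in> S" "y \<in> S" for x y
    using assms(2)[of x y 1] that by simp
  show "c *\<^sub>R x \<in> S" if "x \<in> S" for c x
    using assms(2)[of x 0 c] that assms(1) by simp
qed

lemma subspace_absorb:
  fixes T :: "'v::real_vector set"
  assumes "subspace T" "S \<subseteq> T" "0 \<in> S"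
  shows "S + T = T"
proof
  show "S + T \<subseteq> T"
    using assms subspace_add by (fastforce simp: set_plus_def)
  show "T \<subseteq> S + T"
    using assms(3) by (force simp: set_plus_def)
qed

lemma coset_eq_iff:
  fixes T :: "'v::real_vector set"
  assumes "subspace T"
  shows "a +o T = b +o T \<longleftrightarrow> a - b \<in> T"
proof
  assume eq: "a +o T = b +o T"
  have "a + 0 \<in> b +o T"
    unfolding eq[symmetric] using subspace_0[OF assms] by (rule set_plus_intro2)
  then obtain t where "t \<in> T" "a = b + t"
    unfolding elt_set_plus_def by auto
  then show "a - b \<in> T" by simp
next
  assume d: "a - b \<in> T"
  have d': "b - a \<in> T" using subspace_neg[OF assms d] by simp
  show "a +o T = b +o T"
  proof (intro equalityI subsetI)
    fix y assume "y \<in> a +o T"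
    then obtain t where "t \<in> T" "y = a + t" by (auto simp: elt_set_plus_def)
    then have "y = b + ((a - b) + t)" "(a - b) + t \<in> T"
      using subspace_add[OF assms d] by auto
    then show "y \<in> b +o T" by (metis set_plus_intro2)
  next
    fix y assume "y \<in> b +o T"
    then obtain t where "t \<in> T" "y = b + t" by (auto simp: elt_set_plus_def)
    then have "y = a + ((b - a) + t)" "(b - a) + t \<in> T"
      using subspace_add[OF assms d'] by auto
    then show "y \<in> a +o T" by (metis set_plus_intro2)
  qed
qed

lemma coset_scale_coset:
  fixes B :: "'v::real_vector set"
  assumes "subspace B"
  shows "coset_scale B c (a +o B) = (c *\<^sub>R a) +o B"
proof -
  have "(c *\<^sub>R x) +o B = (c *\<^sub>R a) +o B" if x: "x \<in> a +o B" for x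
  proof -
    obtain b where "b \<in> B" "x = a + b" using x unfolding elt_set_plus_def by blast
    then show ?thesis
      unfolding coset_eq_iff[OF assms] using subspace_scale[OF assms, of b c]
      by (simp add: scaleR_add_right)
  qed
  moreover have "a \<in> a +o B"
    using set_plus_intro2[OF subspace_0[OF assms], of a] by simp
  ultimately show ?thesis
    unfolding coset_scale_def by (intro UN_constant_eq[of a] ballI)
qed

text \<open>The second isomorphism theorem \<open>A/(A \<inter> T) \<cong> (A + T)/T\<close>, with \<open>C = A + T\<close>. As cosets are
  sets, the map induced by the inclusion \<open>A \<subseteq> C\<close> is simply \<open>X \<mapsto> X + T\<close>, since
  \<open>(a + A \<inter> T) + T = a + T\<close>.\<close>

lemma second_isomorphism:
  fixes A T C :: "'v::real_vector set"
  assumes A: "subspace A" and T: "subspace T" and C: "subspace C"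
    and AC: "A \<subseteq> C" and TC: "T \<subseteq> C"
    and span: "\<And>c. c \<in> C \<Longrightarrow> \<exists>a\<in>A. c - a \<in> T"
  shows "\<exists>\<Phi>. bij_betw \<Phi> (quotient_space A (A \<inter> T)) (quotient_space C T) \<and>
    linear_on_cosets A (A \<inter> T) T \<Phi> \<and> (\<forall>a\<in>A. \<Phi> (a +o (A \<inter> T)) = a +o T)"
proof -
  define \<Phi> where "\<Phi> = (\<lambda>X::'v set. X + T)"
  have AT: "subspace (A \<inter> T)" by (rule subspace_inter[OF A T])
  have TT: "T + T = T"
    by (rule subspace_absorb[OF T order_refl subspace_0[OF T]])
  have ATT: "(A \<inter> T) + T = T"
    by (rule subspace_absorb[OF T Int_lower2 subspace_0[OF AT]])
  have ATAT: "(A \<inter> T) + (A \<inter> T) = A \<inter> T"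
    by (rule subspace_absorb[OF AT order_refl subspace_0[OF AT]])
  have Phi: "\<Phi> (a +o (A \<inter> T)) = a +o T" for a
    by (simp add: \<Phi>_def set_plus_rearrange3 ATT)
  have "bij_betw \<Phi> (quotient_space A (A \<inter> T)) (quotient_space C T)"
    unfolding bij_betw_def
  proof
    show "inj_on \<Phi> (quotient_space A (A \<inter> T))"
      by (auto simp: inj_on_def quotient_space_def Phi coset_eq_iff[OF T] coset_eq_iff[OF AT]
          intro: subspace_diff[OF A])
    have "c +o T \<in> (\<lambda>a. a +o T) ` A" if "c \<in> C" for c
      using span[OF that] by (auto simp: coset_eq_iff[OF T])
    then show "\<Phi> ` quotient_space A (A \<inter> T) = quotient_space C T"
      using AC by (auto simp: quotient_space_def image_image Phi)
  qed
  moreover have "linear_on_cosets A (A \<inter> T) T \<Phi>"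
    unfolding linear_on_cosets_def quotient_space_def
    by (auto simp: Phi coset_scale_coset[OF T] coset_scale_coset[OF AT]
        set_plus_rearrange TT ATAT)
  ultimately show ?thesis using Phi by blast
qed

section \<open>Calculus of smooth functions of jet variables\<close>

lemma continuous_on_fun_upd_line:
  "continuous_on A (\<lambda>t::real. (x::jet)(v := t))"
proof (rule continuous_on_coordinatewise_then_product)
  show "continuous_on A (\<lambda>t. (x(v := t)) i)" for i
    by (cases "i = v") auto
qed

lemma eventually_fun_upd_in_open:
  fixes x :: jet
  assumes "open U" "x \<in> U"
  shows "\<forall>\<^sub>F t in nhds (x v). x(v := t) \<in> U"
proof -
  have "open ((\<lambda>t. x(v := t)) -` U)"
    using continuous_on_fun_upd_line assms(1) by (rule open_vimage[rotated])
  moreover have "x v \<in> (\<lambda>t. x(v := t)) -` U" using assms(2) by simp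
  ultimately have "\<forall>\<^sub>F t in nhds (x v). t \<in> (\<lambda>t. x(v := t)) -` U"
    by (rule eventually_nhds_in_open)
  then show ?thesis by simp
qed

lemma pd_cong:
  assumes "open U" "x \<in> U" "\<And>y. y \<in> U \<Longrightarrow> f y = g y"
  shows "pd v f x = pd v g x"
  unfolding pd_def
proof (rule deriv_cong_ev)
  show "\<forall>\<^sub>F t in nhds (x v). f (x(v := t)) = g (x(v := t))"
    using eventually_fun_upd_in_open[OF assms(1,2)] by (rule eventually_mono) (rule assms(3))
qed simp

lemma pd_eqI:
  assumes "((\<lambda>t. f (x(v := t))) has_real_derivative D) (at (x v))"
  shows "pd v f x = D"
  unfolding pd_def by (rule DERIV_imp_deriv[OF assms])

lemma has_real_derivative_pd:
  assumes "smooth_on U f" "x \<in> U"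
  shows "((\<lambda>t. f (x(v := t))) has_real_derivative pd v f x) (at (x v))"
proof -
  have "(\<lambda>t. foldr pd [] f (x(v := t))) field_differentiable at (x v)"
    using assms unfolding smooth_on_def by blast
  then show ?thesis by (simp add: pd_def DERIV_deriv_iff_field_differentiable)
qed

lemma has_real_derivative_pd_line:
  assumes "smooth_on U f" "x(v := t) \<in> U"
  shows "((\<lambda>t. f (x(v := t))) has_real_derivative pd v f (x(v := t))) (at t)"
  using has_real_derivative_pd[OF assms, of v] by simp

lemma smooth_on_imp_continuous_on:
  assumes "smooth_on U f" shows "continuous_on U f"
proof -
  have "continuous_on U (foldr pd [] f)" using assms unfolding smooth_on_def by blast
  then show ?thesis by simp
qed

lemma smooth_on_pd:
  assumes "smooth_on U f" shows "smooth_on U (pd v f)"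
  unfolding smooth_on_def
proof
  fix vs
  have "foldr pd vs (pd v f) = foldr pd (vs @ [v]) f" by simp
  then show "continuous_on U (foldr pd vs (pd v f)) \<and>
      (\<forall>va. \<forall>x\<in>U. (\<lambda>t. foldr pd vs (pd v f) (x(va := t))) field_differentiable at (x va))"
    using assms unfolding smooth_on_def by metis
qed

text \<open>Smoothness by coinduction: a class of continuous functions that is closed under partial
  derivatives consists of smooth functions. The closure only has to hold on \<open>U\<close>, because
  \<^const>\<open>pd\<close> is defined everywhere but is meaningful only there. All closure properties of
  smoothness below are obtained by naming a suitable class \<open>P\<close>.\<close>

lemma smooth_on_coinduct:
  assumes U: "open U" and f: "P f"
    and cont: "\<And>f. P f \<Longrightarrow> continuous_on U f"
    and deriv: "\<And>f v. P f \<Longrightarrow> \<exists>g. P g \<and>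
      (\<forall>x\<in>U. ((\<lambda>t. f (x(v := t))) has_real_derivative g x) (at (x v)))"
  shows "smooth_on U f"
  unfolding smooth_on_def
proof
  fix vs
  have "\<exists>g. P g \<and> (\<forall>x\<in>U. foldr pd vs f x = g x)"
  proof (induction vs)
    case Nil
    then show ?case using f by auto
  next
    case (Cons v vs)
    then obtain g where g: "P g" "\<forall>x\<in>U. foldr pd vs f x = g x" by blast
    obtain h where h: "P h"
      "\<forall>x\<in>U. ((\<lambda>t. g (x(v := t))) has_real_derivative h x) (at (x v))"
      using deriv[OF g(1)] by blast
    have "foldr pd (v # vs) f x = h x" if "x \<in> U" for x
    proof -
      have "foldr pd (v # vs) f x = pd v g x"
        using pd_cong[OF U that, of "foldr pd vs f" g v] g(2) by simp
      then show ?thesis using h(2) that by (simp add: pd_eqI)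
    qed
    then show ?case using h(1) by blast
  qed
  then obtain g where g: "P g" "\<forall>x\<in>U. foldr pd vs f x = g x" by blast
  have "continuous_on U (foldr pd vs f) \<longleftrightarrow> continuous_on U g"
    by (rule continuous_on_cong) (use g(2) in blast)+
  then have "continuous_on U (foldr pd vs f)"
    using cont[OF g(1)] by blast
  moreover have "(\<lambda>t. foldr pd vs f (x(v := t))) field_differentiable at (x v)"
    if x: "x \<in> U" for v x
  proof -
    obtain h where "((\<lambda>t. g (x(v := t))) has_real_derivative h x) (at (x v))"
      using deriv[OF g(1)] x by blast
    moreover have "\<forall>\<^sub>F t in nhds (x v). foldr pd vs f (x(v := t)) = g (x(v := t))"
      using eventually_fun_upd_in_open[OF U x] by (rule eventually_mono) (use g(2) in auto)
    ultimately have "((\<lambda>t. foldr pd vs f (x(v := t))) has_real_derivative h x) (at (x v))"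
      using DERIV_cong_ev[OF refl _ refl] by metis
    then show ?thesis using field_differentiable_def by blast
  qed
  ultimately show "continuous_on U (foldr pd vs f) \<and>
      (\<forall>v. \<forall>x\<in>U. (\<lambda>t. foldr pd vs f (x(v := t))) field_differentiable at (x v))"
    by blast
qed

lemma smooth_on_const:
  assumes "open U" shows "smooth_on U (\<lambda>x. c)"
proof (rule smooth_on_coinduct[OF assms, where P = "\<lambda>f. \<exists>c. f = (\<lambda>x. c)"])
  fix f :: "jet \<Rightarrow> real" and v assume "\<exists>c. f = (\<lambda>x. c)"
  then obtain c where f: "f = (\<lambda>x. c)" by blast
  show "continuous_on U f" by (simp add: f)
  show "\<exists>g. (\<exists>c. g = (\<lambda>x. c)) \<and>
      (\<forall>x\<in>U. ((\<lambda>t. f (x(v := t))) has_real_derivative g x) (at (x v)))"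
    unfolding f by (rule exI[of _ "\<lambda>x. 0"]) auto
qed blast

lemma smooth_on_coordinate:
  assumes U: "open U" shows "smooth_on U (\<lambda>x. x w)"
proof (rule smooth_on_coinduct[OF U, where P = "\<lambda>f. f = (\<lambda>x. x w) \<or> (\<exists>c. f = (\<lambda>x. c))"])
  fix f :: "jet \<Rightarrow> real" and v
  assume f: "f = (\<lambda>x. x w) \<or> (\<exists>c. f = (\<lambda>x. c))"
  show "continuous_on U f"
    using f continuous_on_subset[OF continuous_on_product_coordinates] by auto
  have "((\<lambda>t. f (x(v := t))) has_real_derivative
      (if f = (\<lambda>x. x w) \<and> v = w then 1 else 0)) (at (x v))" for x
    using f by (cases "v = w") auto
  then show "\<exists>g. (g = (\<lambda>x. x w) \<or> (\<exists>c. g = (\<lambda>x. c))) \<and>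
      (\<forall>x\<in>U. ((\<lambda>t. f (x(v := t))) has_real_derivative g x) (at (x v)))"
    by (intro exI[of _ "\<lambda>x. if f = (\<lambda>x. x w) \<and> v = w then 1 else 0"]) auto
qed auto

text \<open>Partial derivatives of a product are sums of products, so the products of smooth functions
  alone do not form a class to which coinduction applies. The algebra that the smooth functions
  generate does, and it settles sums and products at once.\<close>

inductive smooth_algebra :: "jet set \<Rightarrow> (jet \<Rightarrow> real) \<Rightarrow> bool" for U where
  gen: "smooth_on U f \<Longrightarrow> smooth_algebra U f"
| add: "smooth_algebra U f \<Longrightarrow> smooth_algebra U g \<Longrightarrow> smooth_algebra U (\<lambda>x. f x + g x)"
| mult: "smooth_algebra U f \<Longrightarrow> smooth_algebra U g \<Longrightarrow> smooth_algebra U (\<lambda>x. f x * g x)"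

lemma smooth_algebra_imp_smooth_on:
  assumes "open U" "smooth_algebra U f"
  shows "smooth_on U f"
proof (rule smooth_on_coinduct[OF assms(1), where P = "smooth_algebra U"])
  show "smooth_algebra U f" by fact
  show "continuous_on U g" if "smooth_algebra U g" for g
    using that by induction (auto intro: smooth_on_imp_continuous_on continuous_intros)
  show "\<exists>h. smooth_algebra U h \<and>
      (\<forall>x\<in>U. ((\<lambda>t. g (x(v := t))) has_real_derivative h x) (at (x v)))"
    if "smooth_algebra U g" for g v
    using that
  proof induction
    case (gen f)
    then show ?case
      using smooth_on_pd has_real_derivative_pd smooth_algebra.gen by blast
  next
    case (add f g)
    then obtain f' g' where fg: "smooth_algebra U f'" "smooth_algebra U g'"
      "\<forall>x\<in>U. ((\<lambda>t. f (x(v := t))) has_real_derivative f' x) (at (x v))"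
      "\<forall>x\<in>U. ((\<lambda>t. g (x(v := t))) has_real_derivative g' x) (at (x v))" by blast
    have "((\<lambda>t. f (x(v := t)) + g (x(v := t))) has_real_derivative f' x + g' x) (at (x v))"
      if "x \<in> U" for x
      by (rule DERIV_add[OF fg(3)[rule_format, OF that] fg(4)[rule_format, OF that]])
    then show ?case using smooth_algebra.add[OF fg(1,2)] by blast
  next
    case (mult f g)
    then obtain f' g' where fg: "smooth_algebra U f'" "smooth_algebra U g'"
      "\<forall>x\<in>U. ((\<lambda>t. f (x(v := t))) has_real_derivative f' x) (at (x v))"
      "\<forall>x\<in>U. ((\<lambda>t. g (x(v := t))) has_real_derivative g' x) (at (x v))" by blast
    have "((\<lambda>t. f (x(v := t)) * g (x(v := t))) has_real_derivative
        f' x * g x + g' x * f x) (at (x v))" if "x \<in> U" for x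
      using DERIV_mult[OF fg(3)[rule_format, OF that] fg(4)[rule_format, OF that]] by simp
    then show ?case
      using smooth_algebra.add[OF smooth_algebra.mult[OF fg(1) mult.hyps(2)]
          smooth_algebra.mult[OF fg(2) mult.hyps(1)]] by blast
  qed
qed

lemma smooth_on_add: "open U \<Longrightarrow> smooth_on U f \<Longrightarrow> smooth_on U g \<Longrightarrow> smooth_on U (\<lambda>x. f x + g x)"
  by (rule smooth_algebra_imp_smooth_on[OF _ smooth_algebra.add[OF smooth_algebra.gen smooth_algebra.gen]])

lemma smooth_on_mult: "open U \<Longrightarrow> smooth_on U f \<Longrightarrow> smooth_on U g \<Longrightarrow> smooth_on U (\<lambda>x. f x * g x)"
  by (rule smooth_algebra_imp_smooth_on[OF _ smooth_algebra.mult[OF smooth_algebra.gen smooth_algebra.gen]])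

lemma smooth_on_subset: "smooth_on U f \<Longrightarrow> U' \<subseteq> U \<Longrightarrow> smooth_on U' f"
  unfolding smooth_on_def by (meson continuous_on_subset subset_iff)

lemma smooth_on_cong:
  assumes U: "open U" and f: "smooth_on U f" and eq: "\<And>x. x \<in> U \<Longrightarrow> f x = g x"
  shows "smooth_on U g"
proof (rule smooth_on_coinduct[OF U, where P = "\<lambda>g. \<exists>f. smooth_on U f \<and> (\<forall>x\<in>U. f x = g x)"])
  show "\<exists>f. smooth_on U f \<and> (\<forall>x\<in>U. f x = g x)" using f eq by blast
next
  fix g assume "\<exists>f. smooth_on U f \<and> (\<forall>x\<in>U. f x = g x)"
  then obtain f where f: "smooth_on U f" "\<forall>x\<in>U. f x = g x" by blast
  have "continuous_on U f \<longleftrightarrow> continuous_on U g"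
    by (rule continuous_on_cong) (use f(2) in blast)+
  then show "continuous_on U g"
    using smooth_on_imp_continuous_on[OF f(1)] by blast
  fix v
  have "((\<lambda>t. g (x(v := t))) has_real_derivative pd v f x) (at (x v))" if x: "x \<in> U" for x
  proof -
    have "\<forall>\<^sub>F t in nhds (x v). g (x(v := t)) = f (x(v := t))"
      using eventually_fun_upd_in_open[OF U x] by (rule eventually_mono) (use f(2) in auto)
    then show ?thesis
      using has_real_derivative_pd[OF f(1) x] DERIV_cong_ev[OF refl _ refl] by metis
  qed
  then show "\<exists>h. (\<exists>f. smooth_on U f \<and> (\<forall>x\<in>U. f x = h x)) \<and>
      (\<forall>x\<in>U. ((\<lambda>t. g (x(v := t))) has_real_derivative h x) (at (x v)))"
    using smooth_on_pd[OF f(1)] by blast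
qed

text \<open>Smoothness and dependence are bundled, because the constructions below have to keep track of
  the variables that occur.\<close>

definition smooth_in :: "jet set \<Rightarrow> jet_var set \<Rightarrow> (jet \<Rightarrow> real) \<Rightarrow> bool"
  where "smooth_in U S f \<longleftrightarrow> smooth_on U f \<and> depends_only_on U S f"

lemma smooth_in_smooth: "smooth_in U S f \<Longrightarrow> smooth_on U f"
  by (simp add: smooth_in_def)

lemma smooth_in_UNIV: "smooth_on U f \<Longrightarrow> smooth_in U UNIV f"
  unfolding smooth_in_def depends_only_on_def by (metis UNIV_I ext)

lemma smooth_in_mono: "smooth_in U S f \<Longrightarrow> S \<subseteq> S' \<Longrightarrow> smooth_in U S' f"
  unfolding smooth_in_def depends_only_on_def by blast

lemma smooth_in_subset: "smooth_in U S f \<Longrightarrow> U' \<subseteq> U \<Longrightarrow> smooth_in U' S f"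
  unfolding smooth_in_def depends_only_on_def using smooth_on_subset by blast

lemma smooth_in_const: "open U \<Longrightarrow> smooth_in U S (\<lambda>x. c)"
  by (simp add: smooth_in_def depends_only_on_def smooth_on_const)

lemma smooth_in_coordinate: "open U \<Longrightarrow> v \<in> S \<Longrightarrow> smooth_in U S (\<lambda>x. x v)"
  by (simp add: smooth_in_def depends_only_on_def smooth_on_coordinate)

lemma depends_only_on_binop:
  assumes "depends_only_on U S f" "depends_only_on U S g"
  shows "depends_only_on U S (\<lambda>x. h (f x) (g x))"
  unfolding depends_only_on_def
proof (intro ballI impI)
  fix x y assume "x \<in> U" "y \<in> U" "\<forall>v\<in>S. x v = y v"
  then have "f x = f y" "g x = g y" using assms unfolding depends_only_on_def by blast+
  then show "h (f x) (g x) = h (f y) (g y)" by (rule arg_cong2)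
qed

lemma smooth_in_add:
  "open U \<Longrightarrow> smooth_in U S f \<Longrightarrow> smooth_in U S g \<Longrightarrow> smooth_in U S (\<lambda>x. f x + g x)"
  by (simp add: smooth_in_def smooth_on_add depends_only_on_binop)

lemma smooth_in_mult:
  "open U \<Longrightarrow> smooth_in U S f \<Longrightarrow> smooth_in U S g \<Longrightarrow> smooth_in U S (\<lambda>x. f x * g x)"
  by (simp add: smooth_in_def smooth_on_mult depends_only_on_binop)

lemma smooth_in_cmult: "open U \<Longrightarrow> smooth_in U S f \<Longrightarrow> smooth_in U S (\<lambda>x. c * f x)"
  by (rule smooth_in_mult[OF _ smooth_in_const])

lemma smooth_in_minus: "open U \<Longrightarrow> smooth_in U S f \<Longrightarrow> smooth_in U S (\<lambda>x. - f x)"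
  using smooth_in_cmult[of U S f "-1"] by simp

lemma smooth_in_diff:
  "open U \<Longrightarrow> smooth_in U S f \<Longrightarrow> smooth_in U S g \<Longrightarrow> smooth_in U S (\<lambda>x. f x - g x)"
  using smooth_in_add[OF _ _ smooth_in_minus, of U S f g] by simp

lemma smooth_in_sum:
  "open U \<Longrightarrow> (\<And>i. i \<in> I \<Longrightarrow> smooth_in U S (f i)) \<Longrightarrow> smooth_in U S (\<lambda>x. \<Sum>i\<in>I. f i x)"
  by (induction I rule: infinite_finite_induct) (auto intro: smooth_in_const smooth_in_add)

lemma smooth_in_cong:
  assumes "open U" "smooth_in U S f" "\<And>x. x \<in> U \<Longrightarrow> f x = g x"
  shows "smooth_in U S g"
  unfolding smooth_in_def
proof
  show "smooth_on U g" using assms smooth_on_cong smooth_in_smooth by blast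
  show "depends_only_on U S g"
    unfolding depends_only_on_def
  proof (intro ballI impI)
    fix x y assume xy: "x \<in> U" "y \<in> U" "\<forall>v\<in>S. x v = y v"
    then have "f x = f y" using assms(2) unfolding smooth_in_def depends_only_on_def by blast
    then show "g x = g y" by (simp only: assms(3)[OF xy(1)] assms(3)[OF xy(2)])
  qed
qed

text \<open>Variables outside \<open>S\<close> can be varied a little without leaving the open set \<open>U\<close>, and this does not
  change the value of the function.\<close>

lemma pd_eq_0_if_independent:
  assumes U: "open U" and f: "smooth_in U S f" and "v \<notin> S" "x \<in> U"
  shows "pd v f x = 0"
proof (rule pd_eqI)
  have "\<forall>\<^sub>F t in nhds (x v). f (x(v := t)) = f x"
    using eventually_fun_upd_in_open[OF U \<open>x \<in> U\<close>, of v]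
  proof (rule eventually_mono)
    fix t assume "x(v := t) \<in> U"
    moreover have "\<forall>w\<in>S. (x(v := t)) w = x w" using \<open>v \<notin> S\<close> by auto
    ultimately show "f (x(v := t)) = f x"
      using f \<open>x \<in> U\<close> unfolding smooth_in_def depends_only_on_def by blast
  qed
  then show "((\<lambda>t. f (x(v := t))) has_real_derivative 0) (at (x v))"
    using DERIV_cong_ev[OF refl _ refl, of "\<lambda>t. f (x(v := t))" "\<lambda>t. f x" "x v" 0] by simp
qed

lemma smooth_in_pd:
  assumes U: "open U" and f: "smooth_in U S f"
  shows "smooth_in U S (pd v f)"
  unfolding smooth_in_def depends_only_on_def
proof (intro conjI ballI impI)
  show "smooth_on U (pd v f)" using f smooth_on_pd by (simp add: smooth_in_def)
  fix x y assume xy: "x \<in> U" "y \<in> U" "\<forall>w\<in>S. x w = y w"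
  show "pd v f x = pd v f y"
  proof (cases "v \<in> S")
    case True
    then have v: "x v = y v" using xy by blast
    have "\<forall>\<^sub>F t in nhds (x v). x(v := t) \<in> U \<and> y(v := t) \<in> U"
      using eventually_fun_upd_in_open[OF U xy(1), of v] eventually_fun_upd_in_open[OF U xy(2), of v]
      unfolding v by (rule eventually_conj)
    then have "\<forall>\<^sub>F t in nhds (x v). f (x(v := t)) = f (y(v := t))"
    proof (rule eventually_mono)
      fix t assume "x(v := t) \<in> U \<and> y(v := t) \<in> U"
      moreover have "\<forall>w\<in>S. (x(v := t)) w = (y(v := t)) w" using xy by auto
      ultimately show "f (x(v := t)) = f (y(v := t))"
        using f unfolding smooth_in_def depends_only_on_def by blast
    qed
    then show ?thesis unfolding pd_def by (rule deriv_cong_ev) (simp add: v)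
  next
    case False
    then show ?thesis using pd_eq_0_if_independent[OF U f] xy by simp
  qed
qed

lemma pd_const: "pd v (\<lambda>x. c) x = 0"
  by (rule pd_eqI) simp

lemma pd_coordinate: "pd v (\<lambda>x. x w) x = (if v = w then 1 else 0)"
  by (rule pd_eqI) (cases "v = w", auto)

lemma pd_add:
  assumes "smooth_on U f" "smooth_on U g" "x \<in> U"
  shows "pd v (\<lambda>x. f x + g x) x = pd v f x + pd v g x"
  by (rule pd_eqI) (intro DERIV_add has_real_derivative_pd[OF _ assms(3)] assms)

lemma pd_mult:
  assumes "smooth_on U f" "smooth_on U g" "x \<in> U"
  shows "pd v (\<lambda>x. f x * g x) x = pd v f x * g x + f x * pd v g x"
  using DERIV_mult[OF has_real_derivative_pd[OF assms(1,3), of v]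
      has_real_derivative_pd[OF assms(2,3), of v]]
  by (intro pd_eqI) (simp add: algebra_simps)

lemma pd_lincomb:
  assumes "open U" "smooth_on U f" "smooth_on U g" "x \<in> U"
  shows "pd v (\<lambda>x. c * f x + g x) x = c * pd v f x + pd v g x"
  using assms
  by (simp add: pd_add[of U] pd_mult[of U] smooth_on_mult smooth_on_const pd_const)

lemma pd_sum:
  assumes "open U" "\<And>i. i \<in> I \<Longrightarrow> smooth_on U (f i)" "x \<in> U"
  shows "pd v (\<lambda>x. \<Sum>i\<in>I. f i x) x = (\<Sum>i\<in>I. pd v (f i) x)"
proof (rule pd_eqI)
  show "((\<lambda>t. \<Sum>i\<in>I. f i (x(v := t))) has_real_derivative (\<Sum>i\<in>I. pd v (f i) x)) (at (x v))"
    by (intro DERIV_sum has_real_derivative_pd[OF _ assms(3)] assms(2))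
qed

section \<open>Integration with respect to one jet variable\<close>

text \<open>Freezing moves the variables in \<open>C\<close> to their values at the base point \<open>p\<close>. It serves both to
  make a function independent of \<open>C\<close> and, when \<open>p\<close> is on the solution set, to restrict it to
  that set.\<close>

definition freeze :: "jet \<Rightarrow> jet_var set \<Rightarrow> jet \<Rightarrow> jet"
  where "freeze p C x = (\<lambda>v. if v \<in> C then p v else x v)"

definition shrink_coord :: "jet \<Rightarrow> jet_var \<Rightarrow> real \<Rightarrow> jet \<Rightarrow> jet"
  where "shrink_coord p z s x = x(z := p z + s * (x z - p z))"

text \<open>The function \<open>x \<mapsto> \<integral>\<^sub>p\<^sub>z\<^sup>x\<^sup>z f dz\<close> equals \<open>(x z - p z) * \<integral>\<^sub>0\<^sup>1 f(p z + s (x z - p z)) ds\<close>. The second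
  form has a fixed domain of integration and no case distinction on the sign of \<open>x z - p z\<close>.
  The weights \<open>s\<^sup>n\<close> appear when it is differentiated by \<open>z\<close>.\<close>

definition weighted_mean :: "jet \<Rightarrow> jet_var \<Rightarrow> nat \<Rightarrow> (jet \<Rightarrow> real) \<Rightarrow> jet \<Rightarrow> real"
  where "weighted_mean p z n f x = integral {0..1} (\<lambda>s. s ^ n * f (shrink_coord p z s x))"

definition antideriv :: "jet \<Rightarrow> jet_var \<Rightarrow> (jet \<Rightarrow> real) \<Rightarrow> jet \<Rightarrow> real"
  where "antideriv p z f x = (x z - p z) * weighted_mean p z 0 f x"

lemma freeze_upd:
  "freeze p C (x(v := t)) = (if v \<in> C then freeze p C x else (freeze p C x)(v := t))"
  by (auto simp: freeze_def fun_eq_iff)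

lemma pd_freeze:
  "pd v (\<lambda>x. f (freeze p C x)) x = (if v \<in> C then 0 else pd v f (freeze p C x))"
  by (auto simp: pd_def freeze_upd) (simp_all add: freeze_def)

text \<open>Neighbourhoods of \<open>p\<close> in which coordinates may be moved towards \<open>p\<close>. They contain the segments
  along which one integrates and are stable under freezing; open boxes are examples.\<close>

locale shrinkable_nbhd =
  fixes p :: jet and B :: "jet set"
  assumes open_B: "open B" and p_in_B: "p \<in> B"
    and shrink: "\<And>x y. x \<in> B \<Longrightarrow> (\<And>v. \<bar>y v - p v\<bar> \<le> \<bar>x v - p v\<bar>) \<Longrightarrow> y \<in> B"
begin

lemma freeze_in_B: "x \<in> B \<Longrightarrow> freeze p C x \<in> B"
  by (erule shrink) (simp add: freeze_def)

lemma shrink_coord_in_B: "x \<in> B \<Longrightarrow> s \<in> {0..1} \<Longrightarrow> shrink_coord p z s x \<in> B"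
  by (erule shrink) (auto simp: shrink_coord_def abs_mult intro: mult_left_le_one_le)

text \<open>For a variable in \<open>C\<close> the derivative of the composition is \<open>0\<close>, for the others it is the
  derivative of \<open>f\<close> composed with freezing; hence such compositions form a class closed under
  partial derivatives.\<close>

lemma smooth_in_freeze:
  assumes f: "smooth_in B S f"
  shows "smooth_in B (S - C) (\<lambda>x. f (freeze p C x))"
  unfolding smooth_in_def
proof
  show "smooth_on B (\<lambda>x. f (freeze p C x))"
  proof (rule smooth_on_coinduct[OF open_B,
        where P = "\<lambda>h. \<exists>f. smooth_on B f \<and> h = (\<lambda>x. f (freeze p C x))"])
    show "\<exists>g. smooth_on B g \<and> (\<lambda>x. f (freeze p C x)) = (\<lambda>x. g (freeze p C x))"
      using smooth_in_smooth[OF f] by blast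
  next
    fix h assume "\<exists>f. smooth_on B f \<and> h = (\<lambda>x. f (freeze p C x))"
    then obtain f where f: "smooth_on B f" and h: "h = (\<lambda>x. f (freeze p C x))" by blast
    have "continuous_on B (freeze p C)"
    proof (rule continuous_on_coordinatewise_then_product)
      show "continuous_on B (\<lambda>x. freeze p C x i)" for i
        using continuous_on_subset[OF continuous_on_product_coordinates]
        by (cases "i \<in> C") (auto simp: freeze_def)
    qed
    then show "continuous_on B h"
      unfolding h
      by (rule continuous_on_compose2[OF smooth_on_imp_continuous_on[OF f]])
         (auto intro: freeze_in_B)
    fix v
    have "((\<lambda>t. h (x(v := t))) has_real_derivative
        (if v \<in> C then 0 else pd v f (freeze p C x))) (at (x v))" if "x \<in> B" for x
      using has_real_derivative_pd[OF f freeze_in_B[OF that, of C], of v]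
      by (cases "v \<in> C") (auto simp: h freeze_upd, simp add: freeze_def)
    moreover have "\<exists>f'. smooth_on B f' \<and>
        (\<lambda>x. if v \<in> C then 0 else pd v f (freeze p C x)) = (\<lambda>x. f' (freeze p C x))"
      using smooth_on_pd[OF f] smooth_on_const[OF open_B]
      by (intro exI[of _ "if v \<in> C then (\<lambda>x. 0) else pd v f"]) auto
    ultimately show "\<exists>g. (\<exists>f. smooth_on B f \<and> g = (\<lambda>x. f (freeze p C x))) \<and>
        (\<forall>x\<in>B. ((\<lambda>t. h (x(v := t))) has_real_derivative g x) (at (x v)))"
      by (intro exI[of _ "\<lambda>x. if v \<in> C then 0 else pd v f (freeze p C x)"]) blast
  qed
  show "depends_only_on B (S - C) (\<lambda>x. f (freeze p C x))"
    unfolding depends_only_on_def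
  proof (intro ballI impI)
    fix x y assume xy: "x \<in> B" "y \<in> B" "\<forall>v\<in>S - C. x v = y v"
    then have "\<forall>v\<in>S. freeze p C x v = freeze p C y v" by (auto simp: freeze_def)
    then show "f (freeze p C x) = f (freeze p C y)"
      using f freeze_in_B xy unfolding smooth_in_def depends_only_on_def by blast
  qed
qed

lemma continuous_on_weighted_integrand:
  assumes "smooth_on B f"
  shows "continuous_on (B \<times> {0..1}) (\<lambda>(x, s). s ^ n * f (shrink_coord p z s x))"
proof -
  have coord: "continuous_on (B \<times> {0..1}) (\<lambda>xs::jet \<times> real. fst xs i)" for i
    by (rule continuous_on_compose2[OF continuous_on_product_coordinates])
       (auto intro: continuous_intros)
  have "continuous_on (B \<times> {0..1}) (\<lambda>xs. shrink_coord p z (snd xs) (fst xs))"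
  proof (rule continuous_on_coordinatewise_then_product)
    show "continuous_on (B \<times> {0..1}) (\<lambda>xs. shrink_coord p z (snd xs) (fst xs) i)" for i
      using coord by (cases "i = z") (auto simp: shrink_coord_def intro!: continuous_intros)
  qed
  then have "continuous_on (B \<times> {0..1}) (\<lambda>xs. f (shrink_coord p z (snd xs) (fst xs)))"
    by (rule continuous_on_compose2[OF smooth_on_imp_continuous_on[OF assms]])
       (auto intro: shrink_coord_in_B)
  then show ?thesis
    unfolding case_prod_beta by (intro continuous_intros)
qed

lemma continuous_on_weighted_integrand_fixed:
  assumes "smooth_on B f" "x \<in> B"
  shows "continuous_on {0..1} (\<lambda>s. s ^ n * f (shrink_coord p z s x))"
proof -
  have "continuous_on {0..1::real} (Pair x)" by (intro continuous_intros)
  moreover have "Pair x ` {0..1::real} \<subseteq> B \<times> {0..1}" using assms(2) by auto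
  ultimately show ?thesis
    using continuous_on_compose2[OF continuous_on_weighted_integrand[OF assms(1), of n z]]
    by fastforce
qed

lemma has_real_derivative_shrink_coord:
  assumes f: "smooth_on B f" and x: "x(v := t) \<in> B" and s: "s \<in> {0..1}"
  shows "((\<lambda>t. s ^ n * f (shrink_coord p z s (x(v := t)))) has_real_derivative
    s ^ (if v = z then Suc n else n) * pd v f (shrink_coord p z s (x(v := t)))) (at t)"
proof (cases "v = z")
  case True
  have in_B: "x(z := p z + s * (t - p z)) \<in> B"
    using shrink_coord_in_B[OF x s, of z] by (simp add: True shrink_coord_def)
  have "((\<lambda>t. p z + s * (t - p z)) has_real_derivative s) (at t)"
    by (auto intro!: derivative_eq_intros)
  from DERIV_chain2[OF has_real_derivative_pd_line[OF f in_B] this]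
  have "((\<lambda>t. f (x(z := p z + s * (t - p z)))) has_real_derivative
      pd z f (x(z := p z + s * (t - p z))) * s) (at t)" .
  from DERIV_cmult[OF this, of "s ^ n"] show ?thesis
    by (simp add: True shrink_coord_def mult_ac)
next
  case False
  have eq: "shrink_coord p z s (x(v := t)) = (shrink_coord p z s x)(v := t)" for t
    using False by (auto simp: shrink_coord_def fun_eq_iff)
  have "(shrink_coord p z s x)(v := t) \<in> B"
    using shrink_coord_in_B[OF x s, of z] by (simp add: eq)
  from DERIV_cmult[OF has_real_derivative_pd_line[OF f this], of "s ^ n"] show ?thesis
    using False by (simp add: eq)
qed

text \<open>Differentiation under the integral sign. For \<open>v = z\<close> the chain rule produces one more factor
  \<open>s\<close>; this is why the means of all weights are considered together.\<close>

lemma has_real_derivative_weighted_mean: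
  assumes f: "smooth_on B f" and x: "x \<in> B"
  shows "((\<lambda>t. weighted_mean p z n f (x(v := t))) has_real_derivative
    weighted_mean p z (if v = z then Suc n else n) (pd v f) x) (at (x v))"
proof -
  define m where "m = (if v = z then Suc n else n)"
  obtain r where r: "r > 0" "\<And>t. t \<in> ball (x v) r \<Longrightarrow> x(v := t) \<in> B"
    using eventually_fun_upd_in_open[OF open_B x, of v]
    unfolding eventually_nhds_metric by (auto simp: dist_commute)
  have line: "continuous_on (ball (x v) r \<times> {0..1})
      (\<lambda>ts. (x(v := fst ts), snd ts) :: jet \<times> real)"
    by (intro continuous_intros continuous_on_compose2[OF continuous_on_fun_upd_line]) auto
  have "(\<lambda>ts. (x(v := fst ts), snd ts)) ` (ball (x v) r \<times> {0..1}) \<subseteq> B \<times> {0..1}"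
    using r(2) by auto
  from continuous_on_compose2[OF
      continuous_on_weighted_integrand[OF smooth_on_pd[OF f, of v], of m z] line this]
  have "continuous_on (ball (x v) r \<times> {0..1})
      (\<lambda>(t, s). s ^ m * pd v f (shrink_coord p z s (x(v := t))))"
    by (simp add: case_prod_beta)
  then have cont: "continuous_on (ball (x v) r \<times> cbox 0 1)
      (\<lambda>(t, s). s ^ m * pd v f (shrink_coord p z s (x(v := t))))" by simp
  have "((\<lambda>t. integral (cbox 0 1) (\<lambda>s. s ^ n * f (shrink_coord p z s (x(v := t)))))
      has_field_derivative
      integral (cbox 0 1) (\<lambda>s. s ^ m * pd v f (shrink_coord p z s (x(v := x v)))))
      (at (x v) within ball (x v) r)"
  proof (rule leibniz_rule_field_derivative[OF _ _ cont])
    fix t s :: real assume ts: "t \<in> ball (x v) r" "s \<in> cbox 0 1"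
    show "((\<lambda>t. s ^ n * f (shrink_coord p z s (x(v := t)))) has_real_derivative
        s ^ m * pd v f (shrink_coord p z s (x(v := t)))) (at t within ball (x v) r)"
      unfolding m_def
      using has_field_derivative_at_within[OF
          has_real_derivative_shrink_coord[OF f r(2)[OF ts(1)], of s n z]] ts(2) by simp
  next
    fix t assume "t \<in> ball (x v) r"
    show "(\<lambda>s. s ^ n * f (shrink_coord p z s (x(v := t)))) integrable_on cbox 0 1"
      using integrable_continuous_real[OF
          continuous_on_weighted_integrand_fixed[OF f r(2)[OF \<open>t \<in> ball (x v) r\<close>]]]
      by simp
  qed (use r(1) in auto)
  then show ?thesis
    using r(1) at_within_open[of "x v" "ball (x v) r"]
    by (simp add: weighted_mean_def m_def)
qed

lemma smooth_on_weighted_mean: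
  assumes "smooth_on B f"
  shows "smooth_on B (weighted_mean p z n f)"
proof (rule smooth_on_coinduct[OF open_B,
      where P = "\<lambda>h. \<exists>f n. smooth_on B f \<and> h = weighted_mean p z n f"])
  show "\<exists>f' n'. smooth_on B f' \<and> weighted_mean p z n f = weighted_mean p z n' f'"
    using assms by blast
next
  fix h assume "\<exists>f n. smooth_on B f \<and> h = weighted_mean p z n f"
  then obtain f n where f: "smooth_on B f" and h: "h = weighted_mean p z n f" by blast
  show "continuous_on B h"
    using integral_continuous_on_param[of B 0 1 "\<lambda>x s. s ^ n * f (shrink_coord p z s x)"]
      continuous_on_weighted_integrand[OF f, of n z]
    by (simp add: h weighted_mean_def[abs_def])
  show "\<exists>g. (\<exists>f n. smooth_on B f \<and> g = weighted_mean p z n f) \<and>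
      (\<forall>x\<in>B. ((\<lambda>t. h (x(v := t))) has_real_derivative g x) (at (x v)))" for v
    using has_real_derivative_weighted_mean[OF f] smooth_on_pd[OF f] unfolding h by blast
qed

lemma smooth_in_antideriv:
  assumes f: "smooth_in B S f"
  shows "smooth_in B (insert z S) (antideriv p z f)"
proof -
  have "depends_only_on B (insert z S) (weighted_mean p z 0 f)"
    unfolding depends_only_on_def
  proof (intro ballI impI)
    fix x y assume xy: "x \<in> B" "y \<in> B" "\<forall>v\<in>insert z S. x v = y v"
    have "f (shrink_coord p z s x) = f (shrink_coord p z s y)" if "s \<in> {0..1}" for s
    proof -
      have "\<forall>v\<in>S. shrink_coord p z s x v = shrink_coord p z s y v"
        using xy by (auto simp: shrink_coord_def)
      then show ?thesis
        using f shrink_coord_in_B[OF _ that] xy unfolding smooth_in_def depends_only_on_def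
        by blast
    qed
    then show "weighted_mean p z 0 f x = weighted_mean p z 0 f y"
      unfolding weighted_mean_def by (intro Henstock_Kurzweil_Integration.integral_cong) simp
  qed
  then have "smooth_in B (insert z S) (weighted_mean p z 0 f)"
    using smooth_on_weighted_mean f by (simp add: smooth_in_def)
  then show ?thesis
    unfolding antideriv_def[abs_def]
    by (intro smooth_in_mult smooth_in_diff smooth_in_coordinate smooth_in_const open_B) simp_all
qed

lemma antideriv_freeze: "z \<in> C \<Longrightarrow> antideriv p z f (freeze p C x) = 0"
  by (simp add: antideriv_def freeze_def)

lemma pd_antideriv_other:
  assumes f: "smooth_on B f" and x: "x \<in> B" and "v \<noteq> z"
  shows "pd v (antideriv p z f) x = antideriv p z (pd v f) x"
proof (rule pd_eqI)
  show "((\<lambda>t. antideriv p z f (x(v := t))) has_real_derivative antideriv p z (pd v f) x)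
      (at (x v))"
    using DERIV_cmult[OF has_real_derivative_weighted_mean[OF f x, of z 0 v], of "x z - p z"]
      \<open>v \<noteq> z\<close> by (simp add: antideriv_def)
qed

lemma shrink_coord_1: "shrink_coord p z 1 x = x"
  by (simp add: shrink_coord_def)

lemma shrink_coord_0: "shrink_coord p z 0 x = freeze p {z} x"
  by (auto simp: shrink_coord_def freeze_def)

lemma has_real_derivative_along_segment:
  assumes f: "smooth_on B f" and x: "x \<in> B" and s: "s \<in> {0..1}"
  shows "((\<lambda>s. f (shrink_coord p z s x)) has_real_derivative
    (x z - p z) * pd z f (shrink_coord p z s x)) (at s within A)"
proof -
  have in_B: "x(z := p z + s * (x z - p z)) \<in> B"
    using shrink_coord_in_B[OF x s, of z] by (simp add: shrink_coord_def)
  have "((\<lambda>s. p z + s * (x z - p z)) has_real_derivative (x z - p z)) (at s)"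
    by (auto intro!: derivative_eq_intros)
  from DERIV_chain2[OF has_real_derivative_pd_line[OF f in_B] this]
  have "((\<lambda>s. f (shrink_coord p z s x)) has_real_derivative
      (x z - p z) * pd z f (shrink_coord p z s x)) (at s)"
    by (simp add: shrink_coord_def mult_ac)
  then show ?thesis by (rule has_field_derivative_at_within)
qed

text \<open>Fundamental theorem of calculus along the segment that moves the coordinate \<open>z\<close> from its value
  at \<open>p\<close> to its value at \<open>x\<close>.\<close>

lemma antideriv_pd:
  assumes f: "smooth_on B f" and x: "x \<in> B"
  shows "f x = f (freeze p {z} x) + antideriv p z (pd z f) x"
proof -
  have "((\<lambda>s. (x z - p z) * pd z f (shrink_coord p z s x)) has_integral
      f (shrink_coord p z 1 x) - f (shrink_coord p z 0 x)) {0..1}"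
    by (rule fundamental_theorem_of_calculus)
       (auto simp flip: has_real_derivative_iff_has_vector_derivative
          intro: has_real_derivative_along_segment[OF f x])
  then show ?thesis
    by (simp add: antideriv_def weighted_mean_def shrink_coord_1 shrink_coord_0
        has_integral_iff integral_mult_right)
qed

text \<open>The product rule gives the integral of \<open>f + s * d f/d s = d (s * f)/d s\<close> over \<open>[0,1]\<close>.\<close>

lemma pd_antideriv:
  assumes f: "smooth_on B f" and x: "x \<in> B"
  shows "pd z (antideriv p z f) x = f x"
proof (rule pd_eqI)
  let ?D = "weighted_mean p z 0 f x + (x z - p z) * weighted_mean p z 1 (pd z f) x"
  have "((\<lambda>s. f (shrink_coord p z s x) + (x z - p z) * (s * pd z f (shrink_coord p z s x)))
      has_integral 1 * f (shrink_coord p z 1 x) - 0 * f (shrink_coord p z 0 x)) {0..1}"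
  proof (rule fundamental_theorem_of_calculus, simp)
    fix s :: real assume s: "s \<in> {0..1}"
    show "((\<lambda>s. s * f (shrink_coord p z s x)) has_vector_derivative
        f (shrink_coord p z s x) + (x z - p z) * (s * pd z f (shrink_coord p z s x)))
        (at s within {0..1})"
      using DERIV_mult[OF DERIV_ident has_real_derivative_along_segment[OF f x s, of z]]
      by (simp flip: has_real_derivative_iff_has_vector_derivative add: mult_ac add_ac)
  qed
  then have "integral {0..1} (\<lambda>s. f (shrink_coord p z s x) +
      (x z - p z) * (s * pd z f (shrink_coord p z s x))) = f x"
    by (simp add: shrink_coord_1 has_integral_iff)
  moreover have "(\<lambda>s. f (shrink_coord p z s x)) integrable_on {0..1}"
    using continuous_on_weighted_integrand_fixed[OF f x, of 0 z]
    by (simp add: integrable_continuous_real)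
  moreover have "(\<lambda>s. s * pd z f (shrink_coord p z s x)) integrable_on {0..1}"
    using continuous_on_weighted_integrand_fixed[OF smooth_on_pd[OF f] x, of 1 z]
    by (simp add: integrable_continuous_real)
  ultimately have "?D = f x"
    by (simp add: weighted_mean_def integral_add integrable_on_mult_right)
  moreover have "((\<lambda>t. antideriv p z f (x(z := t))) has_real_derivative ?D) (at (x z))"
    using DERIV_mult[OF DERIV_diff[OF DERIV_ident DERIV_const[of "p z"]]
        has_real_derivative_weighted_mean[OF f x, of z 0 z]]
    by (simp add: antideriv_def mult_ac)
  ultimately show "((\<lambda>t. antideriv p z f (x(z := t))) has_real_derivative f x) (at (x z))"
    by simp
qed

text \<open>Symmetry of second derivatives follows from differentiation under the integral sign: writing
  \<open>f\<close> as its value at frozen \<open>z\<close> plus the \<open>z\<close>-integral of \<open>pd z f\<close>, differentiate first by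
  \<open>v\<close> under the integral and then by \<open>z\<close>, which removes the integral.\<close>

lemma pd_commute:
  assumes f: "smooth_on B f" and x: "x \<in> B"
  shows "pd v (pd z f) x = pd z (pd v f) x"
proof (cases "v = z")
  case False
  have sm: "smooth_in B UNIV f" by (rule smooth_in_UNIV[OF f])
  have anti: "smooth_on B (antideriv p z (pd z f))"
    using smooth_in_smooth[OF smooth_in_antideriv[OF smooth_in_pd[OF open_B sm]]] .
  have anti': "smooth_on B (antideriv p z (pd v (pd z f)))"
    using smooth_in_smooth[OF smooth_in_antideriv[OF smooth_in_pd[OF open_B smooth_in_pd[OF open_B sm]]]] .
  have fr: "smooth_on B (\<lambda>x. f (freeze p {z} x))"
    using smooth_in_smooth[OF smooth_in_freeze[OF sm]] .
  have fr': "smooth_on B (\<lambda>x. pd v f (freeze p {z} x))"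
    using smooth_in_smooth[OF smooth_in_freeze[OF smooth_in_pd[OF open_B sm]]] .
  have eq: "pd v f y = pd v f (freeze p {z} y) + antideriv p z (pd v (pd z f)) y"
    if y: "y \<in> B" for y
  proof -
    have "pd v f y = pd v (\<lambda>x. f (freeze p {z} x) + antideriv p z (pd z f) x) y"
      by (rule pd_cong[OF open_B y antideriv_pd[OF f]])
    also have "\<dots> = pd v (\<lambda>x. f (freeze p {z} x)) y + pd v (antideriv p z (pd z f)) y"
      by (rule pd_add[OF fr anti y])
    finally show ?thesis
      using False y by (simp add: pd_freeze pd_antideriv_other smooth_on_pd[OF f])
  qed
  have "pd z (pd v f) x = pd z (\<lambda>x. pd v f (freeze p {z} x) + antideriv p z (pd v (pd z f)) x) x"
    by (rule pd_cong[OF open_B x eq])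
  also have "\<dots> = pd z (\<lambda>x. pd v f (freeze p {z} x)) x + pd z (antideriv p z (pd v (pd z f))) x"
    by (rule pd_add[OF fr' anti' x])
  also have "\<dots> = pd v (pd z f) x"
    by (simp add: pd_freeze pd_antideriv x smooth_on_pd f)
  finally show ?thesis by simp
qed simp

lemma freeze_eq_if_pd_eq_0:
  assumes f: "smooth_on B f" and pd0: "\<And>x. x \<in> B \<Longrightarrow> pd z f x = 0" and x: "x \<in> B"
  shows "f (freeze p {z} x) = f x"
proof -
  have "weighted_mean p z 0 (pd z f) x = integral {0..1} (\<lambda>s::real. 0)"
    unfolding weighted_mean_def
    by (rule Henstock_Kurzweil_Integration.integral_cong)
       (use pd0 shrink_coord_in_B[OF x] in auto)
  then show ?thesis
    using antideriv_pd[OF f x, of z] by (simp add: antideriv_def)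
qed

text \<open>A function whose \<open>z\<close>-derivative vanishes coincides with its version at frozen \<open>z\<close>, because all
  segments in direction \<open>z\<close> towards \<open>p\<close> stay in the neighbourhood.\<close>

lemma smooth_in_remove:
  assumes f: "smooth_in B S f" and pd0: "\<And>x. x \<in> B \<Longrightarrow> pd z f x = 0"
  shows "smooth_in B (S - {z}) f"
  by (rule smooth_in_cong[OF open_B smooth_in_freeze[OF f]
        freeze_eq_if_pd_eq_0[OF smooth_in_smooth[OF f] pd0]])

end

text \<open>A neighbourhood in the product topology contains an open box that restricts only finitely many
  coordinates.\<close>

lemma shrinkable_nbhd_exists:
  assumes "open U" "p \<in> U"
  obtains B where "shrinkable_nbhd p B" "B \<subseteq> U"
proof -
  have "openin (product_topology (\<lambda>i. euclidean) UNIV) U"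
    using assms(1) by (simp add: open_fun_def)
  from product_topology_open_contains_basis[OF this assms(2)]
  obtain X where X: "p \<in> Pi\<^sub>E UNIV X" "\<And>v. open (X v)"
    "finite {v. X v \<noteq> UNIV}" "Pi\<^sub>E UNIV X \<subseteq> U" by auto
  have "\<exists>e>0. ball (p v) e \<subseteq> X v" for v
    using X(1,2) open_contains_ball by (metis PiE_mem UNIV_I)
  then obtain e where e: "\<And>v. e v > 0" "\<And>v. ball (p v) (e v) \<subseteq> X v" by metis
  define T where "T = {v. X v \<noteq> UNIV}"
  define B where "B = {x. \<forall>v\<in>T. x v \<in> ball (p v) (e v)}"
  have openB: "open B"
    unfolding B_def using X(3) product_topology_basis'[of T "\<lambda>v. ball (p v) (e v)" "\<lambda>v. v"]
    by (simp add: T_def)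
  have pB: "p \<in> B" using e(1) by (simp add: B_def)
  have shrink: "y \<in> B" if "x \<in> B" and le: "\<And>v. \<bar>y v - p v\<bar> \<le> \<bar>x v - p v\<bar>" for x y
  proof -
    have "\<bar>y v - p v\<bar> < e v" if "v \<in> T" for v
      using \<open>x \<in> B\<close> le[of v] that
      by (force simp: B_def dist_real_def abs_minus_commute)
    then show ?thesis by (simp add: B_def dist_real_def abs_minus_commute)
  qed
  have "shrinkable_nbhd p B" by (rule shrinkable_nbhd.intro[OF openB pB shrink])
  moreover have "B \<subseteq> U"
    using X(4) e(2) by (fastforce simp: B_def T_def)
  ultimately show ?thesis using that by blast
qed

section \<open>Total derivatives along a chain of variables\<close>

text \<open>On the solution set only \<open>\<xi>, w\<^sub>0\<^sub>0, w\<^sub>1\<^sub>0, w\<^sub>2\<^sub>0, \<dots>\<close> and \<open>\<eta>, w\<^sub>0\<^sub>0, w\<^sub>0\<^sub>1, w\<^sub>0\<^sub>2, \<dots>\<close> survive, and each total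
  derivative becomes \<open>\<partial>\<^bsub>a 0\<^esub> + \<Sum>\<^bsub>i\<ge>1\<^esub> a\<^bsub>i+1\<^esub> \<partial>\<^bsub>a i\<^esub>\<close> for one of these two chains \<open>a\<close> of variables. The
  order bound \<open>M\<close> makes the sum finite; identities such as the commutation of the two operators
  hold for the truncated sums as well. Below, \<open>X\<close> and \<open>Y\<close> stand for these operators along
  the \<open>\<xi>\<close>-chain and the \<open>\<eta>\<close>-chain.\<close>

definition chain_coeff :: "(nat \<Rightarrow> jet_var) \<Rightarrow> nat \<Rightarrow> jet \<Rightarrow> real"
  where "chain_coeff a i x = (if i = 0 then 1 else x (a (Suc i)))"

definition chain_D :: "nat \<Rightarrow> (nat \<Rightarrow> jet_var) \<Rightarrow> (jet \<Rightarrow> real) \<Rightarrow> jet \<Rightarrow> real"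
  where "chain_D M a f x = (\<Sum>i<M. chain_coeff a i x * pd (a i) f x)"

text \<open>Both chains have \<open>w\<^sub>0\<^sub>0\<close> at position 1; they have no other variable in common.\<close>

fun xi_var :: "nat \<Rightarrow> jet_var" where
  "xi_var 0 = Xi"
| "xi_var (Suc k) = W k 0"

fun eta_var :: "nat \<Rightarrow> jet_var" where
  "eta_var 0 = Eta"
| "eta_var (Suc l) = W 0 l"

lemma inj_xi_var: "inj xi_var"
proof (rule injI)
  show "xi_var i = xi_var j \<Longrightarrow> i = j" for i j by (cases i; cases j) auto
qed

lemma inj_eta_var: "inj eta_var"
proof (rule injI)
  show "eta_var i = eta_var j \<Longrightarrow> i = j" for i j by (cases i; cases j) auto
qed

lemma xi_var_eq_iff [simp]: "xi_var i = xi_var j \<longleftrightarrow> i = j"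
  using inj_xi_var by (simp add: inj_eq)

lemma eta_var_eq_iff [simp]: "eta_var i = eta_var j \<longleftrightarrow> i = j"
  using inj_eta_var by (simp add: inj_eq)

lemma xi_var_eq_eta_var_iff [simp]: "xi_var i = eta_var j \<longleftrightarrow> i = 1 \<and> j = 1"
  by (cases i; cases j) auto

lemma eta_var_eq_xi_var_iff [simp]: "eta_var i = xi_var j \<longleftrightarrow> i = 1 \<and> j = 1"
  by (cases i; cases j) auto

text \<open>As \<open>w\<^sub>0\<^sub>0\<close> lies on both chains, counting it on the \<open>\<xi>\<close>-chain alone loses nothing. Thus the sets
  of \<open>\<eta>\<close>-variables below can omit position 1, and \<open>w\<^sub>0\<^sub>0\<close> is eliminated with the \<open>\<xi>\<close>-variables.\<close>

lemma eta_var_image_subset: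
  assumes "1 \<in> I"
  shows "eta_var ` A \<subseteq> xi_var ` I \<union> eta_var ` (A - {1})"
proof
  fix v assume "v \<in> eta_var ` A"
  then obtain l where l: "l \<in> A" "v = eta_var l" by blast
  have "eta_var 1 = xi_var 1" by simp
  then show "v \<in> xi_var ` I \<union> eta_var ` (A - {1})"
    using l assms by (cases "l = 1") blast+
qed

lemmas xi_var_image_iff [simp] = inj_image_mem_iff[OF inj_xi_var]
lemmas eta_var_image_iff [simp] = inj_image_mem_iff[OF inj_eta_var]
declare xi_var.simps(2) [simp del] eta_var.simps(2) [simp del]

lemma pd_chain_coeff: "pd v (chain_coeff a i) x = (if 0 < i \<and> v = a (Suc i) then 1 else 0)"
  by (cases "i = 0") (simp_all add: chain_coeff_def[abs_def] pd_const pd_coordinate)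

context shrinkable_nbhd
begin

lemma smooth_in_chain_coeff: "a (Suc i) \<in> S \<Longrightarrow> smooth_in B S (chain_coeff a i)"
  by (cases "i = 0")
     (simp_all add: chain_coeff_def[abs_def] smooth_in_const smooth_in_coordinate open_B)

lemma smooth_on_chain_coeff: "smooth_on B (chain_coeff a i)"
  by (rule smooth_in_smooth[OF smooth_in_chain_coeff[of a i UNIV]]) simp

lemma smooth_in_chain_D:
  assumes "smooth_in B S f" "S \<subseteq> S'" "a ` {..M} \<subseteq> S'"
  shows "smooth_in B S' (chain_D M a f)"
proof -
  have "smooth_in B S' (chain_coeff a i)" if "i < M" for i
    by (rule smooth_in_chain_coeff) (use assms(3) that in auto)
  moreover have "smooth_in B S' (pd (a i) f)" for i
    by (rule smooth_in_pd[OF open_B smooth_in_mono[OF assms(1,2)]])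
  ultimately show ?thesis
    unfolding chain_D_def[abs_def]
    by (intro smooth_in_sum[OF open_B] smooth_in_mult[OF open_B]) auto
qed

lemma smooth_on_chain_D: "smooth_on B f \<Longrightarrow> smooth_on B (chain_D M a f)"
  by (rule smooth_in_smooth[OF smooth_in_chain_D[OF smooth_in_UNIV, of f UNIV]]) simp_all

lemma chain_D_cong:
  assumes "\<And>x. x \<in> B \<Longrightarrow> f x = g x" "x \<in> B"
  shows "chain_D M a f x = chain_D M a g x"
  unfolding chain_D_def using pd_cong[OF open_B assms(2,1)] by simp

lemma chain_D_eq_0:
  assumes "\<And>x. x \<in> B \<Longrightarrow> f x = 0" "x \<in> B"
  shows "chain_D M a f x = 0"
  using chain_D_cong[of f "\<lambda>x. 0" x M a] assms by (simp add: chain_D_def pd_const)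

lemma chain_D_lincomb:
  assumes "smooth_on B f" "smooth_on B g" "x \<in> B"
  shows "chain_D M a (\<lambda>x. c * f x + g x) x = c * chain_D M a f x + chain_D M a g x"
  unfolding chain_D_def pd_lincomb[OF open_B assms]
  by (simp add: sum.distrib sum_distrib_left algebra_simps)

lemma chain_D_add:
  assumes "smooth_on B f" "smooth_on B g" "x \<in> B"
  shows "chain_D M a (\<lambda>x. f x + g x) x = chain_D M a f x + chain_D M a g x"
  using chain_D_lincomb[OF assms, where c = 1] by simp

lemma chain_D_diff:
  assumes "smooth_on B f" "smooth_on B g" "x \<in> B"
  shows "chain_D M a (\<lambda>x. f x - g x) x = chain_D M a f x - chain_D M a g x"
  using chain_D_lincomb[OF assms(2,1,3), where c = "-1"] by simp

text \<open>Partial derivatives commute, so the only deviation from commutation comes from differentiating the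
  coefficients.\<close>

lemma pd_chain_D:
  assumes f: "smooth_on B f" and x: "x \<in> B"
  shows "pd v (chain_D M a f) x = chain_D M a (pd v f) x +
    (\<Sum>i<M. if 0 < i \<and> v = a (Suc i) then pd (a i) f x else 0)"
proof -
  have "pd v (chain_D M a f) x = (\<Sum>i<M. pd v (\<lambda>x. chain_coeff a i x * pd (a i) f x) x)"
    unfolding chain_D_def[abs_def]
    by (rule pd_sum[OF open_B _ x])
       (rule smooth_on_mult[OF open_B smooth_on_chain_coeff smooth_on_pd[OF f]])
  also have "\<dots> = (\<Sum>i<M. pd v (chain_coeff a i) x * pd (a i) f x + 
      chain_coeff a i x * pd (a i) (pd v f) x)"
    by (simp add: pd_mult[OF smooth_on_chain_coeff smooth_on_pd[OF f] x] pd_commute[OF f x, of v])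
  finally show ?thesis
    by (simp add: pd_chain_coeff chain_D_def sum.distrib add.commute if_distrib[of "\<lambda>c. c * _"] cong: if_cong)
qed

lemma pd_chain_D_other:
  assumes "smooth_on B f" "x \<in> B" "\<And>i. 0 < i \<Longrightarrow> v \<noteq> a (Suc i)"
  shows "pd v (chain_D M a f) x = chain_D M a (pd v f) x"
proof -
  have "(\<Sum>i<M. if 0 < i \<and> v = a (Suc i) then pd (a i) f x else 0) = 0"
    by (rule sum.neutral) (use assms(3) in auto)
  then show ?thesis using pd_chain_D[OF assms(1,2)] by simp
qed

lemma pd_chain_D_Suc:
  assumes "smooth_on B f" "x \<in> B" "inj a" "0 < i" "i < M"
  shows "pd (a (Suc i)) (chain_D M a f) x = chain_D M a (pd (a (Suc i)) f) x + pd (a i) f x"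
proof -
  have "(\<Sum>j<M. if 0 < j \<and> a (Suc i) = a (Suc j) then pd (a j) f x else 0) =
      (\<Sum>j<M. if j = i then pd (a j) f x else 0)"
    by (rule sum.cong) (use assms(3,4) in \<open>auto dest: injD\<close>)
  then show ?thesis using pd_chain_D[OF assms(1,2)] assms(5) by simp
qed

text \<open>Freezing commutes with the operator if it concerns neither the variables by which the operator
  differentiates nor those in its coefficients.\<close>

lemma chain_D_freeze:
  assumes "a ` {..M} \<inter> C = {}"
  shows "chain_D M a (\<lambda>x. f (freeze p C x)) x = chain_D M a f (freeze p C x)"
  unfolding chain_D_def
proof (rule sum.cong)
  fix i assume "i \<in> {..<M}"
  then have "a i \<in> a ` {..M}" "a (Suc i) \<in> a ` {..M}" by auto
  then have "a i \<notin> C" "a (Suc i) \<notin> C" using assms by blast+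
  then show "chain_coeff a i x * pd (a i) (\<lambda>x. f (freeze p C x)) x =
      chain_coeff a i (freeze p C x) * pd (a i) f (freeze p C x)"
    by (simp add: pd_freeze chain_coeff_def) (simp add: freeze_def)
qed simp

text \<open>The coefficients of either operator are constant for the other one. The two chains
  above satisfy this, as \<open>w\<^sub>0\<^sub>0\<close>, their only common variable, occurs in no coefficient.\<close>

lemma chain_D_commute:
  assumes f: "smooth_on B f" and x: "x \<in> B"
    and "\<And>i j. 0 < j \<Longrightarrow> a i \<noteq> b (Suc j)" "\<And>i j. 0 < j \<Longrightarrow> b i \<noteq> a (Suc j)"
  shows "chain_D M a (chain_D N b f) x = chain_D N b (chain_D M a f) x"
proof -
  have "chain_D M a (chain_D N b f) x = (\<Sum>i<M. chain_coeff a i x * chain_D N b (pd (a i) f) x)"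
    unfolding chain_D_def[of M]
    by (intro sum.cong refl arg_cong2[where f = "(*)"] pd_chain_D_other[OF f x] assms(3))
  also have "\<dots> = (\<Sum>i<M. \<Sum>j<N. chain_coeff b j x * (chain_coeff a i x * pd (a i) (pd (b j) f) x))"
    by (simp add: chain_D_def sum_distrib_left pd_commute[OF f x] mult_ac)
  also have "\<dots> = (\<Sum>j<N. chain_coeff b j x * chain_D M a (pd (b j) f) x)"
    by (subst sum.swap) (simp add: chain_D_def sum_distrib_left)
  also have "\<dots> = chain_D N b (chain_D M a f) x"
    unfolding chain_D_def[of N]
    by (intro sum.cong refl arg_cong2[where f = "(*)"] pd_chain_D_other[OF f x, symmetric] assms(4))
  finally show ?thesis .
qed

section \<open>Normal forms of conserved currents\<close>

text \<open>If the \<open>z\<close>-derivative of \<open>F\<close> is a total derivative of \<open>K\<close>, then subtracting the total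
  derivative of the \<open>z\<close>-integral of \<open>K\<close> removes \<open>z\<close> from \<open>F\<close>. The condition on \<open>z\<close> makes
  \<open>\<partial>\<^sub>z\<close> commute with the total derivative.\<close>

lemma pd_sub_chain_D_antideriv:
  assumes F: "smooth_on B F" and K: "smooth_on B K" and x: "x \<in> B"
    and z: "\<And>i. 0 < i \<Longrightarrow> z \<noteq> a (Suc i)"
    and eq: "chain_D M a K x = pd z F x"
  shows "pd z (\<lambda>x. F x - chain_D M a (antideriv p z K) x) x = 0"
proof -
  have H: "smooth_on B (antideriv p z K)"
    by (rule smooth_in_smooth[OF smooth_in_antideriv[OF smooth_in_UNIV[OF K]]])
  have "pd z (\<lambda>x. F x - chain_D M a (antideriv p z K) x) x =
      pd z F x - pd z (chain_D M a (antideriv p z K)) x"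
    using pd_lincomb[OF open_B smooth_on_chain_D[OF H] F x, where c = "-1"] by simp
  also have "pd z (chain_D M a (antideriv p z K)) x = chain_D M a (pd z (antideriv p z K)) x"
    by (rule pd_chain_D_other[OF H x]) (rule z)
  also have "\<dots> = chain_D M a K x" by (rule chain_D_cong[OF pd_antideriv[OF K] x])
  finally show ?thesis using eq by simp
qed

text \<open>Let \<open>z\<^sub>m\<close>, \<open>m > 0\<close>, be the highest \<open>\<xi>\<close>-variable in \<open>F\<close>. Then \<open>X F\<close> is affine in \<open>z\<^bsub>m+1\<^esub>\<close> with slope
  \<open>\<partial>F/\<partial>z\<^sub>m\<close>, so differentiating \<open>X F + Y G = 0\<close> by \<open>z\<^bsub>m+1\<^esub>\<close> shows that \<open>\<partial>F/\<partial>z\<^sub>m\<close> is the \<open>Y\<close>-derivative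
  of \<open>-\<partial>G/\<partial>z\<^bsub>m+1\<^esub>\<close>. The latter may still depend on variables beyond \<open>z\<^sub>m\<close>; since \<open>F\<close> does not, they can
  be frozen, which keeps \<open>H\<close> from bringing them into \<open>F - Y H\<close>.\<close>

lemma eliminate_one_xi_var:
  assumes m: "0 < m" "m < M"
    and F: "smooth_in B (xi_var ` {..m} \<union> eta_var ` ({..M} - {1})) F"
    and G: "smooth_in B (xi_var ` {..M} \<union> eta_var ` {..<M}) G"
    and eq: "\<And>x. x \<in> B \<Longrightarrow> chain_D M xi_var F x + chain_D M eta_var G x = 0"
  shows "\<exists>H. smooth_in B (xi_var ` {..<M} \<union> eta_var ` {..<M}) H \<and>
    smooth_in B (xi_var ` {..<m} \<union> eta_var ` ({..M} - {1})) (\<lambda>x. F x - chain_D M eta_var H x)"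
proof -
  define C where "C = xi_var ` {m<..}"
  define K where "K = (\<lambda>x. - pd (xi_var (Suc m)) G (freeze p C x))"
  define H where "H = antideriv p (xi_var m) K"
  let ?S = "xi_var ` {..m} \<union> eta_var ` {..<M}"
  note sF = smooth_in_smooth[OF F] and sG = smooth_in_smooth[OF G]
  have K: "smooth_in B ?S K"
    unfolding K_def
    by (rule smooth_in_mono[OF smooth_in_minus[OF open_B
          smooth_in_freeze[OF smooth_in_pd[OF open_B G]]]])
       (auto simp: C_def)
  have H: "smooth_in B ?S H"
    unfolding H_def by (rule smooth_in_mono[OF smooth_in_antideriv[OF K]]) auto
  have top: "pd (xi_var m) F x = - chain_D M eta_var (pd (xi_var (Suc m)) G) x" if x: "x \<in> B" for x
  proof -
    let ?v = "xi_var (Suc m)"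
    have "pd ?v F y = 0" if "y \<in> B" for y
      by (rule pd_eq_0_if_independent[OF open_B F _ that]) (use m in auto)
    then have "chain_D M xi_var (pd ?v F) x = 0" by (rule chain_D_eq_0[OF _ x])
    then have XF: "pd ?v (chain_D M xi_var F) x = pd (xi_var m) F x"
      using pd_chain_D_Suc[OF sF x inj_xi_var m] by simp
    have YG: "pd ?v (chain_D M eta_var G) x = chain_D M eta_var (pd ?v G) x"
      by (rule pd_chain_D_other[OF sG x]) (use m in auto)
    have "pd ?v (\<lambda>x. chain_D M xi_var F x + chain_D M eta_var G x) x = pd ?v (\<lambda>x. 0) x"
      by (rule pd_cong[OF open_B x eq])
    then show ?thesis
      using XF YG by (simp add: pd_const pd_add[OF smooth_on_chain_D[OF sF] smooth_on_chain_D[OF sG] x])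
  qed
  have YK: "chain_D M eta_var K x = pd (xi_var m) F x" if x: "x \<in> B" for x
  proof -
    have fr: "smooth_on B (\<lambda>x. pd (xi_var (Suc m)) G (freeze p C x))"
      by (rule smooth_in_smooth[OF smooth_in_freeze[OF smooth_in_pd[OF open_B G]]])
    have "chain_D M eta_var K x =
        - chain_D M eta_var (\<lambda>x. pd (xi_var (Suc m)) G (freeze p C x)) x"
      using chain_D_lincomb[OF fr smooth_on_const[OF open_B, of 0] x, of M eta_var "-1"]
        chain_D_eq_0[of "\<lambda>x. 0" x M eta_var] x
      by (simp add: K_def)
    also have "\<dots> = - chain_D M eta_var (pd (xi_var (Suc m)) G) (freeze p C x)"
      by (subst chain_D_freeze) (use m in \<open>auto simp: C_def\<close>)
    also have "\<dots> = pd (xi_var m) F (freeze p C x)"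
      using top[OF freeze_in_B[OF x]] by simp
    also have "\<dots> = pd (xi_var m) F x"
    proof -
      have "freeze p C x v = x v" if "v \<in> xi_var ` {..m} \<union> eta_var ` ({..M} - {1})" for v
        using that m by (auto simp: freeze_def C_def)
      then show ?thesis
        using smooth_in_pd[OF open_B F, of "xi_var m"] freeze_in_B[OF x] x
        unfolding smooth_in_def depends_only_on_def by blast
    qed
    finally show ?thesis .
  qed
  have "smooth_in B (xi_var ` {..m} \<union> eta_var ` ({..M} - {1})) (chain_D M eta_var H)"
  proof (rule smooth_in_chain_D[OF H])
    show eta: "eta_var ` {..M} \<subseteq> xi_var ` {..m} \<union> eta_var ` ({..M} - {1})"
      by (rule eta_var_image_subset) (use m in simp)
    have "eta_var ` {..<M} \<subseteq> eta_var ` {..M}" by auto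
    with eta show "?S \<subseteq> xi_var ` {..m} \<union> eta_var ` ({..M} - {1})" by blast
  qed
  then have "smooth_in B (xi_var ` {..m} \<union> eta_var ` ({..M} - {1}))
      (\<lambda>x. F x - chain_D M eta_var H x)"
    by (rule smooth_in_diff[OF open_B F])
  moreover have "pd (xi_var m) (\<lambda>x. F x - chain_D M eta_var H x) x = 0" if x: "x \<in> B" for x
    unfolding H_def
    by (rule pd_sub_chain_D_antideriv[OF sF smooth_in_smooth[OF K] x _ YK[OF x]]) simp
  ultimately have "smooth_in B (xi_var ` {..m} \<union> eta_var ` ({..M} - {1}) - {xi_var m})
      (\<lambda>x. F x - chain_D M eta_var H x)"
    by (rule smooth_in_remove)
  then have "smooth_in B (xi_var ` {..<m} \<union> eta_var ` ({..M} - {1}))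
      (\<lambda>x. F x - chain_D M eta_var H x)"
    by (rule smooth_in_mono) (auto simp: le_less)
  moreover have "smooth_in B (xi_var ` {..<M} \<union> eta_var ` {..<M}) H"
    by (rule smooth_in_mono[OF H]) (use m in auto)
  ultimately show ?thesis by blast
qed

text \<open>The variable \<open>\<xi>\<close> itself is removed last: if it is the only \<open>\<xi>\<close>-variable in \<open>F\<close>, then \<open>X F\<close> is just
  \<open>\<partial>F/\<partial>\<xi>\<close>, and \<open>G\<close> takes the role that \<open>\<partial>G/\<partial>z\<^bsub>m+1\<^esub>\<close> has for the other variables. Here \<open>H\<close> may depend
  on \<open>w\<^sub>0\<^sub>0\<close>. Nevertheless \<open>F - Y H\<close> does not: it is independent of \<open>\<xi>\<close>, and at frozen \<open>\<xi>\<close> the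
  integral \<open>H\<close> vanishes, so that \<open>F - Y H\<close> is \<open>F\<close> at frozen \<open>\<xi>\<close>.\<close>

lemma eliminate_xi:
  assumes M: "2 \<le> M"
    and F: "smooth_in B ({Xi} \<union> eta_var ` ({..M} - {1})) F"
    and G: "smooth_in B (xi_var ` {..M} \<union> eta_var ` {..<M}) G"
    and eq: "\<And>x. x \<in> B \<Longrightarrow> chain_D M xi_var F x + chain_D M eta_var G x = 0"
  shows "\<exists>H. smooth_in B (xi_var ` {..<M} \<union> eta_var ` {..<M}) H \<and>
    smooth_in B (eta_var ` ({..M} - {1})) (\<lambda>x. F x - chain_D M eta_var H x)"
proof -
  define C where "C = xi_var ` {2..}"
  define K where "K = (\<lambda>x. - G (freeze p C x))"
  define H where "H = antideriv p Xi K"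
  let ?S = "xi_var ` {..<M} \<union> eta_var ` {..<M}"
  have Xi_eta: "Xi \<noteq> eta_var i" for i
    using xi_var_eq_eta_var_iff[of 0 i] by simp
  have Xi_xi: "xi_var i = Xi \<longleftrightarrow> i = 0" for i
    using xi_var_eq_iff[of i 0] by simp
  note sF = smooth_in_smooth[OF F] and sG = smooth_in_smooth[OF G]
  have "xi_var ` {..M} \<union> eta_var ` {..<M} - C \<subseteq> ?S"
    using M by (fastforce simp: C_def image_iff not_less_eq_eq)
  then have K: "smooth_in B ?S K"
    unfolding K_def
    by (rule smooth_in_mono[OF smooth_in_minus[OF open_B smooth_in_freeze[OF G]]])
  have "Xi \<in> xi_var ` {..<M}" using M by (force intro: image_eqI[of _ _ 0])
  then have H: "smooth_in B ?S H"
    unfolding H_def by (intro smooth_in_mono[OF smooth_in_antideriv[OF K]]) auto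
  have XF: "chain_D M xi_var F x = pd Xi F x" if x: "x \<in> B" for x
  proof -
    have "pd (xi_var i) F x = 0" if "0 < i" for i
      by (rule pd_eq_0_if_independent[OF open_B F _ x]) (use that in \<open>auto simp: Xi_xi Xi_eta\<close>)
    then have "chain_D M xi_var F x = (\<Sum>i<M. if i = 0 then pd Xi F x else 0)"
      unfolding chain_D_def by (intro sum.cong) (auto simp: chain_coeff_def)
    then show ?thesis using M by simp
  qed
  have YK: "chain_D M eta_var K x = pd Xi F x" if x: "x \<in> B" for x
  proof -
    have fr: "smooth_on B (\<lambda>x. G (freeze p C x))"
      by (rule smooth_in_smooth[OF smooth_in_freeze[OF G]])
    have "chain_D M eta_var K x = - chain_D M eta_var (\<lambda>x. G (freeze p C x)) x"
      using chain_D_lincomb[OF fr smooth_on_const[OF open_B, of 0] x, of M eta_var "-1"]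
        chain_D_eq_0[of "\<lambda>x. 0" x M eta_var] x
      by (simp add: K_def)
    also have "\<dots> = - chain_D M eta_var G (freeze p C x)"
      by (subst chain_D_freeze) (auto simp: C_def)
    also have "\<dots> = pd Xi F (freeze p C x)"
      using eq[OF freeze_in_B[OF x, of C]] XF[OF freeze_in_B[OF x, of C]] by simp
    also have "\<dots> = pd Xi F x"
    proof -
      have "Xi \<notin> C" by (auto simp: C_def image_iff Xi_xi eq_commute[of Xi])
      then have "freeze p C x v = x v" if "v \<in> {Xi} \<union> eta_var ` ({..M} - {1})" for v
        using that by (auto simp: freeze_def C_def Xi_xi)
      then show ?thesis
        using smooth_in_pd[OF open_B F, of Xi] freeze_in_B[OF x] x
        unfolding smooth_in_def depends_only_on_def by blast
    qed
    finally show ?thesis .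
  qed
  let ?F' = "\<lambda>x. F x - chain_D M eta_var H x"
  have F': "smooth_on B ?F'"
    using smooth_in_diff[OF open_B smooth_in_UNIV[OF sF]
        smooth_in_UNIV[OF smooth_on_chain_D[OF smooth_in_smooth[OF H]]]]
    by (rule smooth_in_smooth)
  have "F (freeze p {Xi} x) = ?F' x" if x: "x \<in> B" for x
  proof -
    have "?F' x = ?F' (freeze p {Xi} x)"
      by (rule freeze_eq_if_pd_eq_0[OF F' _ x, symmetric])
         (unfold H_def, rule pd_sub_chain_D_antideriv[OF sF smooth_in_smooth[OF K] _ _ YK],
          simp_all add: Xi_eta)
    also have "chain_D M eta_var H (freeze p {Xi} x) = chain_D M eta_var (\<lambda>x. H (freeze p {Xi} x)) x"
      by (rule chain_D_freeze[symmetric]) (use Xi_eta in auto)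
    also have "\<dots> = 0"
      by (rule chain_D_eq_0[OF _ x]) (simp add: H_def antideriv_freeze)
    finally show ?thesis by simp
  qed
  then have "smooth_in B ({Xi} \<union> eta_var ` ({..M} - {1}) - {Xi}) ?F'"
    by (rule smooth_in_cong[OF open_B smooth_in_freeze[OF F]])
  then have "smooth_in B (eta_var ` ({..M} - {1})) ?F'"
    by (rule smooth_in_mono) auto
  then show ?thesis using H by blast
qed

text \<open>Removing one variable changes \<open>(F, G)\<close> to \<open>(F - Y H, G + X H)\<close>, which satisfies the same equation
  because \<open>X\<close> and \<open>Y\<close> commute. The \<open>\<eta>\<close>-variables in \<open>G\<close> stay at positions below \<open>M\<close>,
  hence so do those in every \<open>H\<close>, whereas \<open>Y H\<close> and thus \<open>F - Y H\<close> may reach position \<open>M\<close>.\<close>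

lemma eliminate_xi_vars:
  assumes m: "1 \<le> m" and M: "2 \<le> M"
  shows "m \<le> M \<Longrightarrow> smooth_in B (xi_var ` {..<m} \<union> eta_var ` ({..M} - {1})) F \<Longrightarrow>
    smooth_in B (xi_var ` {..M} \<union> eta_var ` {..<M}) G \<Longrightarrow>
    (\<And>x. x \<in> B \<Longrightarrow> chain_D M xi_var F x + chain_D M eta_var G x = 0) \<Longrightarrow>
    \<exists>H. smooth_in B (xi_var ` {..<M} \<union> eta_var ` {..<M}) H \<and>
      smooth_in B (eta_var ` ({..M} - {1})) (\<lambda>x. F x - chain_D M eta_var H x)"
  using m
proof (induction m arbitrary: F G rule: nat_induct_at_least)
  case base
  then show ?case using eliminate_xi[OF M, of F G] by (simp add: lessThan_Suc)
next
  case (Suc m)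
  have m: "0 < m" "m < M" using Suc by auto
  obtain H1 where H1: "smooth_in B (xi_var ` {..<M} \<union> eta_var ` {..<M}) H1"
    and F1: "smooth_in B (xi_var ` {..<m} \<union> eta_var ` ({..M} - {1}))
      (\<lambda>x. F x - chain_D M eta_var H1 x)"
    using eliminate_one_xi_var[OF m _ Suc.prems(3,4)] Suc.prems(2)
    by (auto simp: lessThan_Suc_atMost)
  note sH1 = smooth_in_smooth[OF H1]
  note sF = smooth_in_smooth[OF Suc.prems(2)] and sG = smooth_in_smooth[OF Suc.prems(3)]
  have G1: "smooth_in B (xi_var ` {..M} \<union> eta_var ` {..<M}) (\<lambda>x. G x + chain_D M xi_var H1 x)"
    by (rule smooth_in_add[OF open_B Suc.prems(3) smooth_in_chain_D[OF H1]]) auto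
  have "chain_D M xi_var (\<lambda>x. F x - chain_D M eta_var H1 x) x +
      chain_D M eta_var (\<lambda>x. G x + chain_D M xi_var H1 x) x = 0" if x: "x \<in> B" for x
  proof -
    have "chain_D M xi_var (chain_D M eta_var H1) x = chain_D M eta_var (chain_D M xi_var H1) x"
      by (rule chain_D_commute[OF sH1 x]) auto
    then show ?thesis
      using Suc.prems(4)[OF x]
      by (simp add: chain_D_diff[OF sF smooth_on_chain_D[OF sH1] x] chain_D_add[OF sG smooth_on_chain_D[OF sH1] x])
  qed
  from Suc.IH[OF _ F1 G1 this] m
  obtain H2 where H2: "smooth_in B (xi_var ` {..<M} \<union> eta_var ` {..<M}) H2"
    and F2: "smooth_in B (eta_var ` ({..M} - {1}))
      (\<lambda>x. F x - chain_D M eta_var H1 x - chain_D M eta_var H2 x)" by auto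
  have "F x - chain_D M eta_var H1 x - chain_D M eta_var H2 x = F x - chain_D M eta_var (\<lambda>x. H1 x + H2 x) x"
    if "x \<in> B" for x
    by (simp add: chain_D_add[OF sH1 smooth_in_smooth[OF H2] that])
  from smooth_in_cong[OF open_B F2 this] smooth_in_add[OF open_B H1 H2]
  show ?case by blast
qed

text \<open>If \<open>Y G = 0\<close>, then differentiating by the variable after the highest \<open>\<eta>\<close>-variable in \<open>G\<close> shows
  that this highest variable does not occur; for \<open>\<eta>\<close> itself \<open>Y G\<close> is \<open>\<partial>G/\<partial>\<eta>\<close>.\<close>

lemma eliminate_eta_vars:
  assumes M: "2 \<le> M"
    and G: "smooth_in B (xi_var ` {..M} \<union> eta_var ` {..<M}) G"
    and eq: "\<And>x. x \<in> B \<Longrightarrow> chain_D M eta_var G x = 0"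
  shows "smooth_in B (xi_var ` ({..M} - {1})) G"
proof -
  let ?S = "xi_var ` {..M} \<union> eta_var ` {..<M}"
  note sG = smooth_in_smooth[OF G]
  have "smooth_in B (?S - eta_var ` {l..}) G" if "l \<le> M" for l
    using that
  proof (induction l rule: inc_induct)
    case base
    show ?case
      by (rule smooth_in_mono[OF G]) (use M in auto)
  next
    case (step l)
    have pd0: "pd (eta_var j) G x = 0" if "l < j" "x \<in> B" for j x
      by (rule pd_eq_0_if_independent[OF open_B step.IH _ that(2)]) (use that(1) in auto)
    have "pd (eta_var l) G x = 0" if x: "x \<in> B" for x
    proof (cases "l = 0")
      case True
      have "chain_D M eta_var G x = (\<Sum>i<M. if i = 0 then pd Eta G x else 0)"
        unfolding chain_D_def using pd0[OF _ x] True by (intro sum.cong) (auto simp: chain_coeff_def)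
      then show ?thesis using M eq[OF x] True by simp
    next
      case False
      have "pd (eta_var (Suc l)) (chain_D M eta_var G) x = pd (eta_var (Suc l)) (\<lambda>x. 0) x"
        by (rule pd_cong[OF open_B x eq])
      moreover have "chain_D M eta_var (pd (eta_var (Suc l)) G) x = 0"
        by (rule chain_D_eq_0[OF pd0 x]) simp_all
      ultimately show ?thesis
        using pd_chain_D_Suc[OF sG x inj_eta_var, of l M] False step.hyps by (simp add: pd_const)
    qed
    from smooth_in_remove[OF step.IH this] show ?case
      by (rule smooth_in_mono) (auto simp: Suc_le_eq le_less)
  qed
  from this[of 0] have "smooth_in B (?S - eta_var ` UNIV) G" by (simp add: atLeast_0)
  then show ?thesis by (rule smooth_in_mono) auto
qed

text \<open>Once \<open>F\<close> is free of \<open>\<xi>\<close>-variables, \<open>X F\<close> vanishes, so \<open>Y\<close> annihilates the second component.\<close>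

lemma normal_form:
  assumes M: "2 \<le> M"
    and F: "smooth_in B (xi_var ` {..<M} \<union> eta_var ` {..<M}) F"
    and G: "smooth_in B (xi_var ` {..<M} \<union> eta_var ` {..<M}) G"
    and eq: "\<And>x. x \<in> B \<Longrightarrow> chain_D M xi_var F x + chain_D M eta_var G x = 0"
  shows "\<exists>H. smooth_in B (xi_var ` {..<M} \<union> eta_var ` {..<M}) H \<and>
    smooth_in B (eta_var ` ({..M} - {1})) (\<lambda>x. F x - chain_D M eta_var H x) \<and>
    smooth_in B (xi_var ` ({..M} - {1})) (\<lambda>x. G x + chain_D M xi_var H x)"
proof -
  have sub: "xi_var ` {..<M} \<union> eta_var ` {..<M} \<subseteq> xi_var ` {..<M} \<union> eta_var ` ({..M} - {1})"
  proof -
    have "eta_var ` {..<M} \<subseteq> xi_var ` {..<M} \<union> eta_var ` ({..<M} - {1})"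
      by (rule eta_var_image_subset) (use M in simp)
    moreover have "eta_var ` ({..<M} - {1}) \<subseteq> eta_var ` ({..M} - {1})" by auto
    ultimately show ?thesis by blast
  qed
  have G': "smooth_in B (xi_var ` {..M} \<union> eta_var ` {..<M}) G"
    by (rule smooth_in_mono[OF G]) auto
  obtain H where H: "smooth_in B (xi_var ` {..<M} \<union> eta_var ` {..<M}) H"
    and F1: "smooth_in B (eta_var ` ({..M} - {1})) (\<lambda>x. F x - chain_D M eta_var H x)"
    using eliminate_xi_vars[of M M F G, OF _ M order_refl smooth_in_mono[OF F sub] G' eq] M by auto
  note sH = smooth_in_smooth[OF H] and sF = smooth_in_smooth[OF F] and sG = smooth_in_smooth[OF G]
  have "smooth_in B (xi_var ` {..M} \<union> eta_var ` {..<M}) (\<lambda>x. G x + chain_D M xi_var H x)"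
    by (rule smooth_in_add[OF open_B G' smooth_in_chain_D[OF H]]) auto
  moreover have "chain_D M eta_var (\<lambda>x. G x + chain_D M xi_var H x) x = 0" if x: "x \<in> B" for x
  proof -
    have "pd (xi_var i) (\<lambda>x. F x - chain_D M eta_var H x) x = 0" for i
      by (rule pd_eq_0_if_independent[OF open_B F1 _ x]) auto
    then have "chain_D M xi_var (\<lambda>x. F x - chain_D M eta_var H x) x = 0" by (simp add: chain_D_def)
    moreover have "chain_D M xi_var (chain_D M eta_var H) x = chain_D M eta_var (chain_D M xi_var H) x"
      by (rule chain_D_commute[OF sH x]) auto
    ultimately show ?thesis
      using eq[OF x]
      by (simp add: chain_D_diff[OF sF smooth_on_chain_D[OF sH] x] chain_D_add[OF sG smooth_on_chain_D[OF sH] x])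
  qed
  ultimately have "smooth_in B (xi_var ` ({..M} - {1})) (\<lambda>x. G x + chain_D M xi_var H x)"
    by (rule eliminate_eta_vars[OF M])
  then show ?thesis using H F1 by blast
qed

end

section \<open>The total derivatives on jet space\<close>

lemma finite_W_indices:
  assumes "finite S" shows "finite {(k, l). W k l \<in> S}"
proof -
  have "finite ((\<lambda>(k, l). W k l) -` S)"
    by (rule finite_vimageI[OF assms]) (auto simp: inj_def)
  then show ?thesis by (simp add: vimage_def case_prod_beta')
qed

lemma sum_pd_eq_sum_superset:
  assumes "open U" "smooth_in U S f" "x \<in> U" "finite A" "{(k, l). W k l \<in> S} \<subseteq> A"
  shows "(\<Sum>(k, l)\<in>{(k, l). pd (W k l) f x \<noteq> 0}. c k l * pd (W k l) f x) =
    (\<Sum>(k, l)\<in>A. c k l * pd (W k l) f x)"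
proof (rule sum.mono_neutral_left[OF assms(4)])
  show "{(k, l). pd (W k l) f x \<noteq> 0} \<subseteq> A"
    using pd_eq_0_if_independent[OF assms(1,2) _ assms(3)] assms(5) by blast
qed auto

lemma D_xi_eq_sum:
  assumes "open U" "smooth_in U S f" "x \<in> U" "finite A" "{(k, l). W k l \<in> S} \<subseteq> A"
  shows "D_xi f x = pd Xi f x + (\<Sum>(k, l)\<in>A. x (W (k + 1) l) * pd (W k l) f x)"
  unfolding D_xi_def using sum_pd_eq_sum_superset[OF assms, of "\<lambda>k l. x (W (k + 1) l)"] by simp

lemma D_eta_eq_sum:
  assumes "open U" "smooth_in U S f" "x \<in> U" "finite A" "{(k, l). W k l \<in> S} \<subseteq> A"
  shows "D_eta f x = pd Eta f x + (\<Sum>(k, l)\<in>A. x (W k (l + 1)) * pd (W k l) f x)"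
  unfolding D_eta_def using sum_pd_eq_sum_superset[OF assms, of "\<lambda>k l. x (W k (l + 1))"] by simp

text \<open>On the solution set the coefficients \<open>w\<^bsub>k+1,l\<^esub>\<close> of \<open>D\<^sub>\<xi>\<close> with \<open>l \<ge> 1\<close> vanish, and so do the coefficients
  \<open>w\<^bsub>k,l+1\<^esub>\<close> of \<open>D\<^sub>\<eta>\<close> with \<open>k \<ge> 1\<close>.\<close>

lemma D_on_solutions_eq_chain_D:
  assumes "open U" "smooth_in U S f" "x \<in> U" "x \<in> solution_set"
    and S: "\<And>k l. W k l \<in> S \<Longrightarrow> k < N \<and> l < N"
  shows "D_xi f x = chain_D (Suc N) xi_var f x" "D_eta f x = chain_D (Suc N) eta_var f x"
proof -
  have A: "finite ({..<N} \<times> {..<N})" "{(k, l). W k l \<in> S} \<subseteq> {..<N} \<times> {..<N}"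
    using S by auto
  have sol: "x (W (Suc k) (Suc l)) = 0" for k l
    using assms(4) by (simp add: solution_set_def)
  have "(\<Sum>l<N. x (W (Suc k) l) * pd (W k l) f x) = x (W (Suc k) 0) * pd (W k 0) f x"
    if "k < N" for k
  proof -
    have "(\<Sum>l<N. x (W (Suc k) l) * pd (W k l) f x) =
        (\<Sum>l<N. if l = 0 then x (W (Suc k) 0) * pd (W k 0) f x else 0)"
      using sol by (intro sum.cong) (auto simp: gr0_conv_Suc)
    then show ?thesis using that by simp
  qed
  then have "(\<Sum>(k, l)\<in>{..<N} \<times> {..<N}. x (W (k + 1) l) * pd (W k l) f x) =
      (\<Sum>k<N. x (W (Suc k) 0) * pd (W k 0) f x)"
    by (simp flip: sum.cartesian_product)
  then show "D_xi f x = chain_D (Suc N) xi_var f x"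
    unfolding D_xi_eq_sum[OF assms(1-3) A] chain_D_def sum.lessThan_Suc_shift
    by (simp add: chain_coeff_def xi_var.simps)
  have "(\<Sum>k<N. x (W k (Suc l)) * pd (W k l) f x) = x (W 0 (Suc l)) * pd (W 0 l) f x"
    if "l < N" for l
  proof -
    have "(\<Sum>k<N. x (W k (Suc l)) * pd (W k l) f x) =
        (\<Sum>k<N. if k = 0 then x (W 0 (Suc l)) * pd (W 0 l) f x else 0)"
      using sol by (intro sum.cong) (auto simp: gr0_conv_Suc)
    then show ?thesis using that by simp
  qed
  then have "(\<Sum>(k, l)\<in>{..<N} \<times> {..<N}. x (W k (l + 1)) * pd (W k l) f x) =
      (\<Sum>l<N. x (W 0 (Suc l)) * pd (W 0 l) f x)"
    by (simp flip: sum.cartesian_product) (subst sum.swap, simp)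
  then show "D_eta f x = chain_D (Suc N) eta_var f x"
    unfolding D_eta_eq_sum[OF assms(1-3) A] chain_D_def sum.lessThan_Suc_shift
    by (simp add: chain_coeff_def eta_var.simps)
qed

lemma smooth_function_of_iff:
  "smooth_function_of A p f \<longleftrightarrow>
    (\<exists>U S. open U \<and> p \<in> U \<and> finite S \<and> S \<subseteq> A \<and> smooth_in U S f)"
  by (simp add: smooth_function_of_def smooth_in_def)

lemma smooth_function_ofI:
  "open U \<Longrightarrow> p \<in> U \<Longrightarrow> finite S \<Longrightarrow> S \<subseteq> A \<Longrightarrow> smooth_in U S f \<Longrightarrow> smooth_function_of A p f"
  unfolding smooth_function_of_iff by blast

lemma smooth_function_of_common:
  assumes "smooth_function_of A p f" "smooth_function_of A p g"
  obtains U S where "open U" "p \<in> U" "finite S" "S \<subseteq> A" "smooth_in U S f" "smooth_in U S g"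
proof -
  obtain U S where f: "open U" "p \<in> U" "finite S" "S \<subseteq> A" "smooth_in U S f"
    using assms(1) unfolding smooth_function_of_iff by blast
  obtain U' S' where g: "open U'" "p \<in> U'" "finite S'" "S' \<subseteq> A" "smooth_in U' S' g"
    using assms(2) unfolding smooth_function_of_iff by blast
  show ?thesis
  proof (rule that[of "U \<inter> U'" "S \<union> S'"])
    show "smooth_in (U \<inter> U') (S \<union> S') f"
      by (rule smooth_in_mono[OF smooth_in_subset[OF f(5)]]) auto
    show "smooth_in (U \<inter> U') (S \<union> S') g"
      by (rule smooth_in_mono[OF smooth_in_subset[OF g(5)]]) auto
  qed (use f g in auto)
qed

lemma smooth_function_of_lincomb:
  assumes "smooth_function_of A p f" "smooth_function_of A p g"
  shows "smooth_function_of A p (\<lambda>x. c * f x + g x)"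
proof -
  obtain U S where US: "open U" "p \<in> U" "finite S" "S \<subseteq> A" "smooth_in U S f" "smooth_in U S g"
    using smooth_function_of_common[OF assms] .
  have "smooth_in U S (\<lambda>x. c * f x + g x)"
    by (rule smooth_in_add[OF US(1) smooth_in_cmult[OF US(1,5)] US(6)])
  then show ?thesis using US(1-4) unfolding smooth_function_of_iff by blast
qed

lemma smooth_function_of_const: "smooth_function_of A p (\<lambda>x. c)"
  unfolding smooth_function_of_iff
  by (intro exI[of _ UNIV] exI[of _ "{}"]) (simp add: smooth_in_const)

lemma smooth_function_of_imp_differential_function:
  "smooth_function_of A p f \<Longrightarrow> differential_function p f"
  unfolding differential_function_def smooth_function_of_iff by blast

lemmas differential_function_lincomb =
  smooth_function_of_lincomb[of UNIV, folded differential_function_def]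

lemma differential_function_sum_pd:
  assumes "open U" "p \<in> U" "finite S" "smooth_in U S f" "finite A"
    and eq: "\<And>x. x \<in> U \<Longrightarrow> g x = pd v f x + (\<Sum>(k, l)\<in>A. x (h k l) * pd (W k l) f x)"
  shows "differential_function p g"
proof -
  let ?S = "S \<union> (\<lambda>(k, l). h k l) ` A"
  have pd: "smooth_in U ?S (pd v f)" for v
    by (rule smooth_in_mono[OF smooth_in_pd[OF assms(1,4)]]) auto
  have "smooth_in U ?S (\<lambda>x. pd v f x + (\<Sum>kl\<in>A. x (h (fst kl) (snd kl)) * pd (W (fst kl) (snd kl)) f x))"
    by (rule smooth_in_add[OF assms(1) pd smooth_in_sum[OF assms(1)]],
        rule smooth_in_mult[OF assms(1) smooth_in_coordinate[OF assms(1)] pd]) force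
  then have "smooth_in U ?S g"
    by (rule smooth_in_cong[OF assms(1)]) (simp add: eq case_prod_beta)
  then show ?thesis
    unfolding differential_function_def
    by (rule smooth_function_ofI[OF assms(1,2), rotated 2]) (use assms(3,5) in auto)
qed

lemma differential_function_D:
  assumes "differential_function p f"
  shows "differential_function p (D_xi f)" "differential_function p (D_eta f)"
proof -
  obtain U S where US: "open U" "p \<in> U" "finite S" "smooth_in U S f"
    using assms unfolding differential_function_def smooth_function_of_iff by blast
  note A = finite_W_indices[OF US(3)]
  show "differential_function p (D_xi f)"
    by (rule differential_function_sum_pd[OF US A D_xi_eq_sum[OF US(1,4) _ A order_refl]])
  show "differential_function p (D_eta f)"
    by (rule differential_function_sum_pd[OF US A D_eta_eq_sum[OF US(1,4) _ A order_refl]])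
qed

lemma D_lincomb:
  assumes "differential_function p f" "differential_function p g"
  shows "\<forall>\<^sub>F x in nhds p. D_xi (\<lambda>x. c * f x + g x) x = c * D_xi f x + D_xi g x \<and>
    D_eta (\<lambda>x. c * f x + g x) x = c * D_eta f x + D_eta g x"
proof -
  obtain U S where US: "open U" "p \<in> U" "finite S" "smooth_in U S f" "smooth_in U S g"
    using smooth_function_of_common[OF assms[unfolded differential_function_def]] .
  let ?h = "\<lambda>x. c * f x + g x"
  have h: "smooth_in U S ?h"
    by (rule smooth_in_add[OF US(1) smooth_in_cmult[OF US(1,4)] US(5)])
  note A = finite_W_indices[OF US(3)]
  have "D_xi ?h x = c * D_xi f x + D_xi g x \<and> D_eta ?h x = c * D_eta f x + D_eta g x"
    if x: "x \<in> U" for x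
  proof -
    have pd: "pd v ?h x = c * pd v f x + pd v g x" for v
      by (rule pd_lincomb[OF US(1) smooth_in_smooth[OF US(4)] smooth_in_smooth[OF US(5)] x])
    show ?thesis
      unfolding D_xi_eq_sum[OF US(1) h x A order_refl] D_xi_eq_sum[OF US(1,4) x A order_refl]
        D_xi_eq_sum[OF US(1,5) x A order_refl] D_eta_eq_sum[OF US(1) h x A order_refl]
        D_eta_eq_sum[OF US(1,4) x A order_refl] D_eta_eq_sum[OF US(1,5) x A order_refl]
      by (simp add: pd case_prod_beta sum.distrib sum_distrib_left distrib_left mult_ac)
  qed
  then show ?thesis
    using eventually_nhds_in_open[OF US(1,2)] by (auto elim: eventually_mono)
qed

lemma D_zero: "D_xi (\<lambda>x. 0) x = 0" "D_eta (\<lambda>x. 0) x = 0"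
  by (simp_all add: D_xi_def D_eta_def pd_const)

section \<open>Conserved currents and their equivalence\<close>

lemma current_lincomb:
  fixes F1 G1 F2 G2 :: "jet \<Rightarrow> real"
  shows "c *\<^sub>R (F1, G1) + (F2, G2) = (\<lambda>x. c * F1 x + F2 x, \<lambda>x. c * G1 x + G2 x)"
  by (simp add: fun_eq_iff scaleR_fun_def)

lemma zero_current: "(0 :: current) = (\<lambda>x. 0, \<lambda>x. 0)"
  by (simp add: zero_prod_def zero_fun_def)

lemma subspace_V: "subspace (V p)"
proof (rule subspaceI_lincomb)
  show "0 \<in> V p" by (simp add: V_def zero_current smooth_function_of_const)
  fix c :: real and x y assume "x \<in> V p" "y \<in> V p"
  then show "c *\<^sub>R x + y \<in> V p"
    by (cases x; cases y) (simp only: current_lincomb, simp add: V_def smooth_function_of_lincomb)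
qed

lemma vanishes_on_solutions_lincomb:
  assumes "vanishes_on_solutions p f" "vanishes_on_solutions p g"
  shows "vanishes_on_solutions p (\<lambda>x. c * f x + g x)"
  using eventually_conj[OF assms[unfolded vanishes_on_solutions_def]]
  unfolding vanishes_on_solutions_def by (rule eventually_mono) simp

lemma conserved_currents_lincomb:
  assumes "(F1, G1) \<in> conserved_currents p" "(F2, G2) \<in> conserved_currents p"
  shows "(\<lambda>x. c * F1 x + F2 x, \<lambda>x. c * G1 x + G2 x) \<in> conserved_currents p"
proof -
  have F: "differential_function p F1" "differential_function p F2"
    and G: "differential_function p G1" "differential_function p G2"
    and v: "vanishes_on_solutions p (\<lambda>x. D_xi F1 x + D_eta G1 x)"
      "vanishes_on_solutions p (\<lambda>x. D_xi F2 x + D_eta G2 x)"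
    using assms by (auto simp: conserved_currents_def)
  have "\<forall>\<^sub>F x in nhds p. x \<in> solution_set \<longrightarrow>
      D_xi (\<lambda>x. c * F1 x + F2 x) x + D_eta (\<lambda>x. c * G1 x + G2 x) x = 0"
    using D_lincomb[OF F, of c] D_lincomb[OF G, of c]
      vanishes_on_solutions_lincomb[OF v, of c, unfolded vanishes_on_solutions_def]
    by eventually_elim (auto simp: algebra_simps)
  then show ?thesis
    using F G by (simp add: conserved_currents_def vanishes_on_solutions_def
        differential_function_lincomb)
qed

lemma zero_in_conserved_currents: "0 \<in> conserved_currents p"
  by (simp add: conserved_currents_def zero_current differential_function_def
      smooth_function_of_const vanishes_on_solutions_def D_zero)

lemma subspace_conserved_currents: "subspace (conserved_currents p)"
proof (rule subspaceI_lincomb[OF zero_in_conserved_currents])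
  fix c :: real and x y assume "x \<in> conserved_currents p" "y \<in> conserved_currents p"
  then show "c *\<^sub>R x + y \<in> conserved_currents p"
    by (cases x; cases y) (simp only: current_lincomb conserved_currents_lincomb)
qed

lemma subspace_trivial_currents: "subspace (trivial_currents p)"
proof (rule subspaceI_lincomb)
  have "\<exists>F' G' H. differential_function p F' \<and> differential_function p G' \<and>
      differential_function p H \<and> vanishes_on_solutions p F' \<and> vanishes_on_solutions p G' \<and>
      (\<forall>\<^sub>F x in nhds p. 0 = F' x + D_eta H x \<and> 0 = G' x - D_xi H x)"
    by (intro exI[of _ "\<lambda>x. 0"])
       (simp add: differential_function_def smooth_function_of_const
          vanishes_on_solutions_def D_zero)
  then show "0 \<in> trivial_currents p"
    using zero_in_conserved_currents[of p] by (simp add: trivial_currents_def zero_current)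
next
  fix c :: real and x y assume xy: "x \<in> trivial_currents p" "y \<in> trivial_currents p"
  obtain F1 G1 F2 G2 where x: "x = (F1, G1)" and y: "y = (F2, G2)" by (cases x; cases y)
  obtain F1' G1' H1 where 1: "differential_function p F1'" "differential_function p G1'"
      "differential_function p H1" "vanishes_on_solutions p F1'" "vanishes_on_solutions p G1'"
      "\<forall>\<^sub>F x in nhds p. F1 x = F1' x + D_eta H1 x \<and> G1 x = G1' x - D_xi H1 x"
    using xy(1) unfolding x trivial_currents_def by blast
  obtain F2' G2' H2 where 2: "differential_function p F2'" "differential_function p G2'"
      "differential_function p H2" "vanishes_on_solutions p F2'" "vanishes_on_solutions p G2'"
      "\<forall>\<^sub>F x in nhds p. F2 x = F2' x + D_eta H2 x \<and> G2 x = G2' x - D_xi H2 x"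
    using xy(2) unfolding y trivial_currents_def by blast
  have "(\<lambda>x. c * F1 x + F2 x, \<lambda>x. c * G1 x + G2 x) \<in> conserved_currents p"
    by (rule conserved_currents_lincomb) (use xy x y in \<open>auto simp: trivial_currents_def\<close>)
  moreover have "\<forall>\<^sub>F x in nhds p.
      c * F1 x + F2 x = (c * F1' x + F2' x) + D_eta (\<lambda>x. c * H1 x + H2 x) x \<and>
      c * G1 x + G2 x = (c * G1' x + G2' x) - D_xi (\<lambda>x. c * H1 x + H2 x) x"
    using 1(6) 2(6) D_lincomb[OF 1(3) 2(3), of c]
    by eventually_elim (simp add: distrib_left right_diff_distrib)
  moreover note differential_function_lincomb[OF 1(1) 2(1), of c]
    differential_function_lincomb[OF 1(2) 2(2), of c]
    differential_function_lincomb[OF 1(3) 2(3), of c]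
    vanishes_on_solutions_lincomb[OF 1(4) 2(4), of c]
    vanishes_on_solutions_lincomb[OF 1(5) 2(5), of c]
  ultimately show "c *\<^sub>R x + y \<in> trivial_currents p"
    unfolding x y current_lincomb trivial_currents_def by blast
qed

lemma W_index_bound:
  assumes "finite S"
  shows "\<exists>N>0. \<forall>k l. W k l \<in> S \<longrightarrow> k < N \<and> l < N"
proof -
  let ?I = "{(k, l). W k l \<in> S}"
  have "finite (fst ` ?I \<union> snd ` ?I)" using finite_W_indices[OF assms] by simp
  then obtain N where N: "\<forall>n\<in>fst ` ?I \<union> snd ` ?I. n < N"
    using finite_nat_set_iff_bounded by blast
  have "k < Suc N \<and> l < Suc N" if "W k l \<in> S" for k l
  proof -
    have "(k, l) \<in> ?I" using that by simp
    then have "k \<in> fst ` ?I" "l \<in> snd ` ?I" by force+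
    then show ?thesis using N by (simp add: less_SucI)
  qed
  then show ?thesis by blast
qed

text \<open>On solutions \<open>D\<^sub>\<xi>\<close> differentiates only by \<open>\<xi>\<close>-variables, on which \<open>F\<close> does not depend; likewise
  for \<open>D\<^sub>\<eta>\<close> and \<open>G\<close>.\<close>

lemma V_subset_conserved_currents: "V p \<subseteq> conserved_currents p"
proof (rule subrelI)
  fix F G assume "(F, G) \<in> V p"
  then have F: "smooth_function_of ({Eta} \<union> {W 0 l | l. l \<ge> 1}) p F"
    and G: "smooth_function_of ({Xi} \<union> {W k 0 | k. k \<ge> 1}) p G"
    by (auto simp: V_def)
  obtain U S where U: "open U" "p \<in> U" "finite S" "S \<subseteq> {Eta} \<union> {W 0 l | l. l \<ge> 1}"
    "smooth_in U S F" using F unfolding smooth_function_of_iff by blast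
  obtain U' S' where U': "open U'" "p \<in> U'" "finite S'" "S' \<subseteq> {Xi} \<union> {W k 0 | k. k \<ge> 1}"
    "smooth_in U' S' G" using G unfolding smooth_function_of_iff by blast
  obtain N where N: "\<forall>k l. W k l \<in> S \<union> S' \<longrightarrow> k < N \<and> l < N"
    using W_index_bound[OF finite_UnI[OF U(3) U'(3)]] by blast
  have "D_xi F x + D_eta G x = 0" if x: "x \<in> U \<inter> U'" "x \<in> solution_set" for x
  proof -
    have "xi_var i \<notin> S" for i using U(4) by (cases i) (auto simp: xi_var.simps)
    then have "pd (xi_var i) F x = 0" for i
      using pd_eq_0_if_independent[OF U(1,5)] x by blast
    moreover have "eta_var i \<notin> S'" for i using U'(4) by (cases i) (auto simp: eta_var.simps)
    then have "pd (eta_var i) G x = 0" for i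
      using pd_eq_0_if_independent[OF U'(1,5)] x by blast
    ultimately show ?thesis
      using D_on_solutions_eq_chain_D(1)[OF U(1,5) _ x(2), of N]
        D_on_solutions_eq_chain_D(2)[OF U'(1,5) _ x(2), of N] N x(1)
      by (simp add: chain_D_def)
  qed
  moreover have "\<forall>\<^sub>F x in nhds p. x \<in> U \<inter> U'"
    by (rule eventually_nhds_in_open) (use U(1,2) U'(1,2) in auto)
  ultimately have "vanishes_on_solutions p (\<lambda>x. D_xi F x + D_eta G x)"
    unfolding vanishes_on_solutions_def by (auto elim: eventually_mono)
  then show "(F, G) \<in> conserved_currents p"
    using F G by (simp add: conserved_currents_def smooth_function_of_imp_differential_function)
qed

text \<open>It suffices to find \<open>H\<close>: the remainders that vanish on solutions are then determined as
  differences.\<close>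

lemma trivial_currentI:
  assumes FG: "(F, G) \<in> conserved_currents p" and H: "differential_function p H"
    and "vanishes_on_solutions p (\<lambda>x. F x - D_eta H x)"
    and "vanishes_on_solutions p (\<lambda>x. G x + D_xi H x)"
  shows "(F, G) \<in> trivial_currents p"
proof -
  have "differential_function p (\<lambda>x. F x - D_eta H x)"
    using differential_function_lincomb[OF differential_function_D(2)[OF H], of F "-1"] FG
    by (simp add: conserved_currents_def)
  moreover have "differential_function p (\<lambda>x. G x + D_xi H x)"
    using differential_function_lincomb[OF differential_function_D(1)[OF H], of G 1] FG
    by (simp add: conserved_currents_def add.commute)
  moreover have "\<forall>\<^sub>F x in nhds p. F x = (F x - D_eta H x) + D_eta H x \<and>
      G x = (G x + D_xi H x) - D_xi H x" by simp
  ultimately show ?thesis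
    unfolding trivial_currents_def using FG H assms(3,4) by blast
qed

text \<open>Restricting \<open>F\<close> and \<open>G\<close> to the solution set by freezing all \<open>w\<^sub>k\<^sub>l\<close> with \<open>k, l \<ge> 1\<close> changes them by
  functions vanishing on solutions and turns the conservation condition into an identity
  \<open>X F + Y G = 0\<close> on a full neighbourhood. The normal form of the restricted current lies in \<open>V\<close>, and
  its \<open>H\<close> witnesses the equivalence, as \<open>D\<^sub>\<xi> H = X H\<close> and \<open>D\<^sub>\<eta> H = Y H\<close> on solutions.\<close>

lemma conserved_current_equivalent_to_V:
  assumes p: "p \<in> solution_set" and FG: "(F, G) \<in> conserved_currents p"
  shows "\<exists>c\<in>V p. (F, G) - c \<in> trivial_currents p"
proof -
  have dF: "differential_function p F" and dG: "differential_function p G"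
    and "vanishes_on_solutions p (\<lambda>x. D_xi F x + D_eta G x)"
    using FG by (auto simp: conserved_currents_def)
  then obtain U' where U': "open U'" "p \<in> U'"
    "\<And>x. x \<in> U' \<Longrightarrow> x \<in> solution_set \<Longrightarrow> D_xi F x + D_eta G x = 0"
    unfolding vanishes_on_solutions_def eventually_nhds by blast
  obtain U S where U: "open U" "p \<in> U" "finite S" "smooth_in U S F" "smooth_in U S G"
    using smooth_function_of_common[OF dF[unfolded differential_function_def]
        dG[unfolded differential_function_def]] .
  obtain B where "shrinkable_nbhd p B" and B: "B \<subseteq> U \<inter> U'"
    using shrinkable_nbhd_exists[of "U \<inter> U'" p] U U' by blast
  then interpret shrinkable_nbhd p B by simp
  obtain N where N: "0 < N" "\<And>k l. W k l \<in> S \<Longrightarrow> k < N \<and> l < N"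
    using W_index_bound[OF U(3)] by metis
  \<comment> \<open>Jet variables of order below \<open>N\<close> have positions up to \<open>N\<close> in the two chains.\<close>
  define M where "M = Suc N"
  define C where "C = {W k l | k l. 1 \<le> k \<and> 1 \<le> l}"
  let ?S = "xi_var ` {..<M} \<union> eta_var ` {..<M}"
  have F: "smooth_in B S F" and G: "smooth_in B S G"
    using smooth_in_subset[OF U(4)] smooth_in_subset[OF U(5)] B by auto
  have sub: "S - C \<subseteq> ?S"
  proof
    fix v assume v: "v \<in> S - C"
    show "v \<in> ?S"
    proof (cases v)
      case Xi
      then have "v = xi_var 0" by simp
      moreover have "0 < M" by (simp add: M_def)
      ultimately show ?thesis by blast
    next
      case Eta
      then have "v = eta_var 0" by simp
      moreover have "0 < M" by (simp add: M_def)
      ultimately show ?thesis by blast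
    next
      case (W k l)
      then have "k < N" "l < N" "k = 0 \<or> l = 0" using v N(2) by (auto simp: C_def)
      then have "v = xi_var (Suc k) \<or> v = eta_var (Suc l)" "Suc k < M" "Suc l < M"
        using W by (auto simp: xi_var.simps eta_var.simps M_def)
      then show ?thesis by auto
    qed
  qed
  have F1: "smooth_in B ?S (\<lambda>x. F (freeze p C x))"
    by (rule smooth_in_mono[OF smooth_in_freeze[OF F] sub])
  have G1: "smooth_in B ?S (\<lambda>x. G (freeze p C x))"
    by (rule smooth_in_mono[OF smooth_in_freeze[OF G] sub])
  have disj: "xi_var ` A \<inter> C = {}" "eta_var ` A \<inter> C = {}" for A
    unfolding C_def by (auto elim!: xi_var.elims eta_var.elims)
  have freeze_sol: "freeze p C x \<in> solution_set" for x
    using p by (auto simp: solution_set_def freeze_def C_def)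
  have freeze_id: "freeze p C x = x" if "x \<in> solution_set" for x
    using that p by (auto simp: solution_set_def freeze_def C_def fun_eq_iff)
  have eq: "chain_D M xi_var (\<lambda>x. F (freeze p C x)) x + chain_D M eta_var (\<lambda>x. G (freeze p C x)) x = 0"
    if x: "x \<in> B" for x
  proof -
    note y = freeze_in_B[OF x, of C]
    have "D_xi F (freeze p C x) = chain_D M xi_var F (freeze p C x)"
      unfolding M_def by (rule D_on_solutions_eq_chain_D(1)[OF open_B F y freeze_sol N(2)])
    moreover have "D_eta G (freeze p C x) = chain_D M eta_var G (freeze p C x)"
      unfolding M_def by (rule D_on_solutions_eq_chain_D(2)[OF open_B G y freeze_sol N(2)])
    ultimately show ?thesis
      using U'(3)[OF _ freeze_sol, of x] y B by (auto simp: chain_D_freeze disj)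
  qed
  have "2 \<le> M" using N(1) by (simp add: M_def)
  from normal_form[OF this F1 G1 eq] obtain H where H: "smooth_in B ?S H"
    and F0: "smooth_in B (eta_var ` ({..M} - {1}))
      (\<lambda>x. F (freeze p C x) - chain_D M eta_var H x)" (is "smooth_in B _ ?F0")
    and G0: "smooth_in B (xi_var ` ({..M} - {1}))
      (\<lambda>x. G (freeze p C x) + chain_D M xi_var H x)" (is "smooth_in B _ ?G0") by blast
  have dH: "differential_function p H"
    unfolding differential_function_def
    by (rule smooth_function_ofI[OF open_B p_in_B _ _ H]) auto
  have "eta_var i \<in> {Eta} \<union> {W 0 l | l. l \<ge> 1}" if "i \<noteq> 1" for i
    using that by (cases i) (auto simp: eta_var.simps)
  moreover have "xi_var i \<in> {Xi} \<union> {W k 0 | k. k \<ge> 1}" if "i \<noteq> 1" for i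
    using that by (cases i) (auto simp: xi_var.simps)
  ultimately have "smooth_function_of ({Eta} \<union> {W 0 l | l. l \<ge> 1}) p ?F0"
    "smooth_function_of ({Xi} \<union> {W k 0 | k. k \<ge> 1}) p ?G0"
    by (intro smooth_function_ofI[OF open_B p_in_B _ _ F0]
        smooth_function_ofI[OF open_B p_in_B _ _ G0]; blast)+
  then have V: "(?F0, ?G0) \<in> V p" by (simp add: V_def)
  have HN: "k < N \<and> l < N" if "W k l \<in> ?S" for k l
    using that N(1) by (auto simp: M_def elim!: xi_var.elims[OF sym] eta_var.elims[OF sym])
  have near: "\<forall>\<^sub>F x in nhds p. x \<in> B" by (rule eventually_nhds_in_open[OF open_B p_in_B])
  have "(\<lambda>x. F x - ?F0 x, \<lambda>x. G x - ?G0 x) \<in> trivial_currents p"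
  proof (rule trivial_currentI[OF _ dH])
    have "(F, G) - (?F0, ?G0) \<in> conserved_currents p"
      using subspace_diff[OF subspace_conserved_currents FG] V V_subset_conserved_currents
      by blast
    then show "(\<lambda>x. F x - ?F0 x, \<lambda>x. G x - ?G0 x) \<in> conserved_currents p"
      by (simp add: fun_diff_def)
    have "x \<in> B \<Longrightarrow> x \<in> solution_set \<Longrightarrow> F x - ?F0 x - D_eta H x = 0" for x
      using D_on_solutions_eq_chain_D(2)[OF open_B H _ _ HN, of x] by (simp add: freeze_id M_def)
    then show "vanishes_on_solutions p (\<lambda>x. F x - ?F0 x - D_eta H x)"
      unfolding vanishes_on_solutions_def using near by (auto elim: eventually_mono)
    have "x \<in> B \<Longrightarrow> x \<in> solution_set \<Longrightarrow> G x - ?G0 x + D_xi H x = 0" for x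
      using D_on_solutions_eq_chain_D(1)[OF open_B H _ _ HN, of x] by (simp add: freeze_id M_def)
    then show "vanishes_on_solutions p (\<lambda>x. G x - ?G0 x + D_xi H x)"
      unfolding vanishes_on_solutions_def using near by (auto elim: eventually_mono)
  qed
  then have "(F, G) - (?F0, ?G0) \<in> trivial_currents p" by (simp add: fun_diff_def)
  then show ?thesis using V by blast
qed

theorem theorem4:
  fixes p :: jet
  assumes "p \<in> solution_set"
  shows "subspace (conserved_currents p) \<and> subspace (trivial_currents p) \<and>
    subspace (V p) \<and> subspace (V\<^sub>0 p) \<and> V p \<subseteq> conserved_currents p \<and>
    (\<exists>\<Phi>. bij_betw \<Phi> (quotient_space (V p) (V\<^sub>0 p)) (conservation_laws p) \<and>
       linear_on_cosets (V p) (V\<^sub>0 p) (trivial_currents p) \<Phi> \<and>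
       (\<forall>c\<in>V p. \<Phi> (c +o V\<^sub>0 p) = c +o trivial_currents p))"
proof -
  have TC: "trivial_currents p \<subseteq> conserved_currents p"
    by (auto simp: trivial_currents_def)
  have span: "\<exists>c\<in>V p. d - c \<in> trivial_currents p" if "d \<in> conserved_currents p" for d
    using that conserved_current_equivalent_to_V[OF assms] by (cases d) simp
  show ?thesis
    unfolding V\<^sub>0_def conservation_laws_def
    by (intro conjI subspace_conserved_currents subspace_trivial_currents subspace_V
        subspace_inter[OF subspace_V subspace_trivial_currents] V_subset_conserved_currents
        second_isomorphism[OF subspace_V subspace_trivial_currents subspace_conserved_currents
          V_subset_conserved_currents TC span])
qed

end
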